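(* Let $a>0$, let $q\in L^2(0,a)$ be complex-valued, and let $\alpha_0\ge0$, $\alpha>0$, $\beta_0,\beta\in\mathbb{C}$. Assume that $q(x)$ is known a priori a.e. on $(b,a)$ with $b\in(0,a)$, and that $\alpha$ and $\beta$ are given. Let $\Omega_+$ and $\Omega_-$ be sets of zeros of $\Delta_+$ and $\Delta_-$, respectively (i.e. subsets of the respective zero sets), and let $\Omega_0=\Omega_+\cup\Omega_-$. If $\Omega_0$ satisfies $$n_{\Omega_0}(r)=\frac{2mr}{\pi}[1+o(1)],\qquad r\to\infty,\qquad m>2b,$$ then $\Omega_0$ uniquely determines $\alpha_0$, $\beta_0$ and $q(x)$ a.e. on $(0,b)$.
   Context: Let $y(\lambda,x)$ be the solution of $-y''+q(x)y=\lambda^2y$ on $(0,a)$ with $y(\lambda,0)=1$, $y'(\lambda,0)=i\alpha_0\lambda+\beta_0$ (prime is $d/dx$, $\lambda\in\mathbb{C}$). Put $$\Delta_\pm(\lambda)=y'(\lambda,a)+(\pm i\alpha\lambda+\beta)y(\lambda,a).$$ These are entire functions, the characteristic functions of the boundary value problems $-y''+qy=\lambda^2y$, $y'(0)-(i\alpha_0\lambda+\beta_0)y(0)=0$, $y'(a)+(\pm i\alpha\lambda+\beta)y(a)=0$. $n_{\Omega_0}(r)$ is the number of points in $\Omega_0\cap\{\lambda:|\lambda|\le r\}$. "Uniquely determines" means: if a second problem with data $(\tilde q,\tilde\alpha_0,\tilde\beta_0,\alpha,\beta)$, $\tilde q=q$ a.e. on $(b,a)$, $\tilde\alpha_0\ge0$,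 $\tilde\beta_0\in\mathbb{C}$, is such that the points of $\Omega_+$ are also zeros of its function $\tilde\Delta_+$ and the points of $\Omega_-$ are also zeros of its function $\tilde\Delta_-$, then $\tilde\alpha_0=\alpha_0$, $\tilde\beta_0=\beta_0$ and $\tilde q=q$ a.e. on $(0,b)$. *)

theory Defs
  imports "HOL-Analysis.Analysis" "HOL-Library.Landau_Symbols"
begin

definition L2_on :: "real \<Rightarrow> real \<Rightarrow> (real \<Rightarrow> complex) \<Rightarrow> bool" where
  "L2_on c d q \<longleftrightarrow>
     q \<in> borel_measurable (lebesgue_on {c<..<d}) \<and>
     integrable (lebesgue_on {c<..<d}) (\<lambda>x. (norm (q x))\<^sup>2)"

text \<open>
  Since \<open>q\<close> is merely square integrable, \<open>- y'' + q y = l\<^sup>2 y\<close> on \<open>(0,a)\<close> is understood in the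
  usual sense: \<open>y\<close> is continuously differentiable on \<open>[0,a]\<close> with derivative \<open>dy\<close> (one-sided at
  the end points), \<open>dy\<close> is absolutely continuous, i.e. an indefinite integral of some integrable
  \<open>ddy\<close> (the almost everywhere second derivative), and the equation holds almost everywhere.
\<close>

definition SL_solution ::
    "real \<Rightarrow> (real \<Rightarrow> complex) \<Rightarrow> complex \<Rightarrow> (real \<Rightarrow> complex) \<Rightarrow> (real \<Rightarrow> complex) \<Rightarrow> bool" where
  "SL_solution a q l y dy \<longleftrightarrow>
     (\<forall>x\<in>{0..a}. (y has_vector_derivative dy x) (at x within {0..a})) \<and>
     (\<exists>ddy. integrable (lebesgue_on {0..a}) ddy \<and>
        (\<forall>x\<in>{0..a}. dy x = dy 0 + (LINT t|lebesgue_on {0..x}. ddy t)) \<and>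
        (AE x in lebesgue_on {0<..<a}. - ddy x + q x * y x = l\<^sup>2 * y x))"

text \<open>
  \<open>y l x\<close> is the solution \<open>y(l, x)\<close> normalised at \<open>0\<close>, and \<open>dy l x\<close> is its derivative in \<open>x\<close>.
  These conditions determine \<open>y l\<close> and \<open>dy l\<close> on \<open>[0,a]\<close>; values elsewhere are irrelevant.
\<close>

definition SL_initial_family ::
    "real \<Rightarrow> (real \<Rightarrow> complex) \<Rightarrow> real \<Rightarrow> complex \<Rightarrow>
     (complex \<Rightarrow> real \<Rightarrow> complex) \<Rightarrow> (complex \<Rightarrow> real \<Rightarrow> complex) \<Rightarrow> bool" where
  "SL_initial_family a q \<alpha>0 \<beta>0 y dy \<longleftrightarrow>
     (\<forall>l. SL_solution a q l (y l) (dy l) \<and>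
          y l 0 = 1 \<and> dy l 0 = \<i> * of_real \<alpha>0 * l + \<beta>0)"

definition Delta_plus ::
    "real \<Rightarrow> real \<Rightarrow> complex \<Rightarrow>
     (complex \<Rightarrow> real \<Rightarrow> complex) \<Rightarrow> (complex \<Rightarrow> real \<Rightarrow> complex) \<Rightarrow> complex \<Rightarrow> complex" where
  "Delta_plus a \<alpha> \<beta> y dy l = dy l a + (\<i> * of_real \<alpha> * l + \<beta>) * y l a"

definition Delta_minus ::
    "real \<Rightarrow> real \<Rightarrow> complex \<Rightarrow>
     (complex \<Rightarrow> real \<Rightarrow> complex) \<Rightarrow> (complex \<Rightarrow> real \<Rightarrow> complex) \<Rightarrow> complex \<Rightarrow> complex" where
  "Delta_minus a \<alpha> \<beta> y dy l = dy l a + (- \<i> * of_real \<alpha> * l + \<beta>) * y l a"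

text \<open>
  Points are counted without multiplicity. The convention that an infinite set has cardinality \<open>0\<close>
  is harmless when the count is asymptotic to \<open>c * r\<close> with \<open>c > 0\<close>: it is then nonzero for all
  large \<open>r\<close>, so every \<open>S \<inter> cball 0 r\<close> is finite.
\<close>

definition count_upto :: "complex set \<Rightarrow> real \<Rightarrow> nat" where
  "count_upto S r = card (S \<inter> {l. norm l \<le> r})"

end

theory Submission
  imports Defs "HOL-Complex_Analysis.Complex_Analysis"
begin

text \<open>
  Write \<open>y\<close> and \<open>z\<close> for the normalised solutions of the two problems, with potentials \<open>q\<close> and \<open>p\<close>,
  and let \<open>W(l) = y(l,b) z'(l,b) - y'(l,b) z(l,b)\<close>.  At a point of \<open>\<Omega>p\<close> both solutions satisfy the
  same boundary condition at \<open>a\<close>, so their Wronskian vanishes there, and likewise at a point of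
  \<open>\<Omega>m\<close>.  The derivative of the Wronskian in \<open>x\<close> is \<open>(p - q) y z\<close>, which is zero almost everywhere on
  \<open>(b,a)\<close>; so the Wronskian also vanishes at \<open>b\<close>, and \<open>W\<close> is zero on \<open>\<Omega>0\<close>.  It does not matter which
  of the two conditions a point came from.

  The entire function \<open>W\<close> is bounded by \<open>K (1 + |l|) exp (2 b |Im l|)\<close> (\<open>wronskian_growth\<close>).  By
  Jensen's inequality a nonzero function of this growth has at most about \<open>4 b r / pi\<close> zeros of modulus at
  most \<open>r\<close> in the logarithmic mean, while \<open>\<Omega>0\<close> has \<open>2 m r / pi\<close> points with \<open>m > 2 b\<close>.  Hence
  \<open>W = 0\<close> identically (\<open>entire_zero_count_imp_zero\<close>).

  So \<open>y'/y\<close> and \<open>z'/z\<close> agree at \<open>b\<close> for every \<open>l\<close>, and what is left is a theorem of Borg-Marchenko type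
  (\<open>borg_marchenko\<close>).  Let \<open>C\<close>, \<open>S\<close> and \<open>C'\<close>, \<open>S'\<close> be the cosine- and sine-type solutions based at \<open>b\<close>
  for \<open>q\<close> and \<open>p\<close>; on these two letters the prime marks the second problem, not a derivative.  For fixed \<open>x\<close> the function \<open>D = C S' - C' S\<close> is entire and even in \<open>l\<close>, it is
  bounded on horizontal strips, and \<open>W = 0\<close> gives
  \<open>D(l) = y(x)/y(b) S'(x) - z(x)/z(b) S(x)\<close>.  In the lower half-plane the initial slope
  \<open>i \<alpha>0 l + \<beta>0\<close> with \<open>\<alpha>0 \<ge> 0\<close> excites the exponentially growing mode: the factor multiplying
  \<open>exp (i l x)\<close> tends to \<open>(1 + \<alpha>0) / 2\<close>, which is never zero.  This is the one place
  where the sign of \<open>\<alpha>0\<close> matters; it makes \<open>y(x)/y(b)\<close> decay like \<open>exp (- |Im l| (b - x))\<close>, which cancels the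
  growth of \<open>S'\<close> and leaves \<open>D(l) = O(1/|l|)\<close> there.  By evenness and Liouville's theorem \<open>D = 0\<close>.
  The equation \<open>C S' = C' S\<close> and the two Wronskian normalisations force \<open>S'\<^sup>2 = S\<^sup>2\<close>, and differentiating
  twice gives \<open>p = q\<close> almost everywhere on \<open>(0,b)\<close>.  Then the Wronskian of \<open>y\<close> and \<open>z\<close> is constant on \<open>[0,b]\<close>,
  hence zero at \<open>0\<close>, where it is the difference of the two initial slopes, an affine function of \<open>l\<close>.
\<close>

section \<open>Absolutely continuous functions as indefinite integrals\<close>

text \<open>
  The integral form of "\<open>F\<close> is absolutely continuous on \<open>[0,a]\<close> with almost everywhere derivative \<open>f\<close>".
  An integrable potential enters the equation only through such integrals.
\<close>

definition ac_deriv :: "real \<Rightarrow> (real \<Rightarrow> 'a::{real_normed_field,euclidean_space}) \<Rightarrow> (real \<Rightarrow> 'a) \<Rightarrow> bool" where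
  "ac_deriv a F f \<longleftrightarrow> f absolutely_integrable_on {0..a} \<and> (\<forall>x\<in>{0..a}. F x = F 0 + integral {0..x} f)"

lemma ac_deriv_integrable: "ac_deriv a F f \<Longrightarrow> f absolutely_integrable_on {0..a}"
  by (simp add: ac_deriv_def)

lemma ac_deriv_HK_integrable: "ac_deriv a F f \<Longrightarrow> f integrable_on {0..a}"
  by (simp add: ac_deriv_def absolutely_integrable_on_def)

lemma ac_deriv_eq: "ac_deriv a F f \<Longrightarrow> 0 \<le> x \<Longrightarrow> x \<le> a \<Longrightarrow> F x = F 0 + integral {0..x} f"
  unfolding ac_deriv_def by (meson atLeastAtMost_iff)

lemma ac_derivI:
  "f absolutely_integrable_on {0..a} \<Longrightarrow> (\<And>x. 0 \<le> x \<Longrightarrow> x \<le> a \<Longrightarrow> F x - F 0 = integral {0..x} f) \<Longrightarrow> ac_deriv a F f"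
  unfolding ac_deriv_def by (metis add.commute atLeastAtMost_iff diff_add_cancel)

lemma abs_integrable_subinterval:
  fixes f :: "real \<Rightarrow> 'a::{real_normed_field,euclidean_space}"
  assumes "f absolutely_integrable_on {0..a}" "0 \<le> x" "y \<le> a"
  shows "f absolutely_integrable_on {x..y}"
  using assms by (intro absolutely_integrable_on_subinterval[OF assms(1)]) auto

lemma ac_deriv_diff:
  assumes "ac_deriv a F f" "0 \<le> x" "x \<le> y" "y \<le> a"
  shows "F y - F x = integral {x..y} f"
proof -
  have "f absolutely_integrable_on {0..y}"
    using assms by (intro abs_integrable_subinterval[of a f 0 y]) (auto dest: ac_deriv_integrable)
  then have "integral {0..x} f + integral {x..y} f = integral {0..y} f"
    using assms by (intro Henstock_Kurzweil_Integration.integral_combine) (auto intro: absolutely_integrable_imp_integrable simp: absolutely_integrable_on_def)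
  moreover have "F y = F 0 + integral {0..y} f" "F x = F 0 + integral {0..x} f"
    using assms by (auto intro!: ac_deriv_eq)
  ultimately show ?thesis by (simp add: algebra_simps)
qed

lemma ac_deriv_continuous:
  assumes "ac_deriv a F f"
  shows "continuous_on {0..a} F"
proof -
  have "f integrable_on {0..a}" using assms by (rule ac_deriv_HK_integrable)
  then have "continuous_on {0..a} (\<lambda>x. integral {0..x} f)" by (rule indefinite_integral_continuous_1)
  then have "continuous_on {0..a} (\<lambda>x. F 0 + integral {0..x} f)" by (intro continuous_intros)
  then show ?thesis
    by (rule continuous_on_eq) (auto intro!: ac_deriv_eq[OF assms, symmetric])
qed

lemma ac_deriv_subinterval:
  assumes "ac_deriv a F f" "b \<le> a"
  shows "ac_deriv b F f"
  using assms abs_integrable_subinterval[OF ac_deriv_integrable[OF assms(1)], of 0 b] ac_deriv_diff[OF assms(1), of 0]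
  by (intro ac_derivI) auto

lemma abs_integrable_continuous_mult:
  fixes f :: "real \<Rightarrow> 'a::{real_normed_field,euclidean_space}"
  assumes "continuous_on {0..a} g" "f absolutely_integrable_on {0..a}"
  shows "(\<lambda>x. g x * f x) absolutely_integrable_on {0..a}" "(\<lambda>x. f x * g x) absolutely_integrable_on {0..a}"
proof -
  show 1: "(\<lambda>x. g x * f x) absolutely_integrable_on {0..a}"
  proof (rule absolutely_integrable_bounded_measurable_product[where h = "(*)"])
    show "bilinear ((*) :: 'a \<Rightarrow> 'a \<Rightarrow> 'a)" by (simp add: bilinear_times)
    show "g \<in> borel_measurable (lebesgue_on {0..a})"
      using assms(1) by (intro continuous_imp_measurable_on_sets_lebesgue) auto
    show "bounded (g ` {0..a})"
      using assms(1) by (intro compact_imp_bounded compact_continuous_image) auto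
  qed (use assms in auto)
  then show "(\<lambda>x. f x * g x) absolutely_integrable_on {0..a}" by (simp add: mult.commute)
qed

lemma ac_deriv_const: "ac_deriv a (\<lambda>x. c) (\<lambda>x. 0)"
  by (intro ac_derivI) auto

lemma ac_deriv_add:
  assumes "ac_deriv a F f" "ac_deriv a G g"
  shows "ac_deriv a (\<lambda>x. F x + G x) (\<lambda>x. f x + g x)"
proof (rule ac_derivI)
  show "(\<lambda>x. f x + g x) absolutely_integrable_on {0..a}"
    using assms by (intro set_integral_add ac_deriv_integrable)
  fix x assume x: "0 \<le> x" "x \<le> a"
  have "integral {0..x} (\<lambda>x. f x + g x) = integral {0..x} f + integral {0..x} g"
    using ac_deriv_subinterval[OF assms(1) x(2)] ac_deriv_subinterval[OF assms(2) x(2)]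
    by (intro integral_add ac_deriv_HK_integrable)
  then show "F x + G x - (F 0 + G 0) = integral {0..x} (\<lambda>x. f x + g x)"
    using ac_deriv_diff[OF assms(1), of 0 x] ac_deriv_diff[OF assms(2), of 0 x] x
    by (simp add: algebra_simps)
qed

lemma ac_deriv_C1:
  assumes "\<And>x. x \<in> {0..a} \<Longrightarrow> (F has_vector_derivative f x) (at x within {0..a})" "continuous_on {0..a} f"
  shows "ac_deriv a F f"
proof (rule ac_derivI)
  show "f absolutely_integrable_on {0..a}" using assms(2) by (rule absolutely_integrable_continuous_real)
  fix x assume x: "0 \<le> x" "x \<le> a"
  have "(f has_integral (F x - F 0)) {0..x}"
    using x by (intro fundamental_theorem_of_calculus has_vector_derivative_within_subset[OF assms(1)]) auto
  then show "F x - F 0 = integral {0..x} f" by (simp add: integral_unique)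
qed

lemma ac_deriv_has_vector_derivative:
  assumes "ac_deriv a F f" "continuous_on {0..a} f" "x \<in> {0..a}"
  shows "(F has_vector_derivative f x) (at x within {0..a})"
proof -
  have "((\<lambda>u. F 0 + integral {0..u} f) has_vector_derivative f x) (at x within {0..a})"
    using integral_has_vector_derivative[OF assms(2,3)] by (auto intro!: derivative_eq_intros)
  then show ?thesis
    by (rule has_vector_derivative_transform[rotated 2]) (use assms in \<open>auto intro: ac_deriv_eq\<close>)
qed

text \<open>
  On a short interval \<open>[u,v]\<close> the increment of \<open>F G\<close> differs from the integral of \<open>f G + F g\<close> by
  the integral of \<open>f (G v - G) + (F u - F) g\<close>, which is small compared with the integral
  of \<open>|f| + |g|\<close> because \<open>F\<close> and \<open>G\<close> are continuous.  Such estimates are additive over adjacent intervals, so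
  Bolzano's bisection principle extends them to \<open>[0,x]\<close>; then \<open>e\<close> tends to \<open>0\<close>.
\<close>

lemma ac_deriv_mult:
  assumes F: "ac_deriv a F f" and G: "ac_deriv a G g"
  shows "ac_deriv a (\<lambda>x. F x * G x) (\<lambda>x. f x * G x + F x * g x)"
proof -
  define h where "h = (\<lambda>x. f x * G x + F x * g x)"
  define k where "k = (\<lambda>x. norm (f x) + norm (g x))"
  have cF: "continuous_on {0..a} F" and cG: "continuous_on {0..a} G"
    using F G by (auto intro: ac_deriv_continuous)
  have fi: "f absolutely_integrable_on {0..a}" and gi: "g absolutely_integrable_on {0..a}"
    using F G by (auto intro: ac_deriv_integrable)
  have hi: "h absolutely_integrable_on {0..a}"
    unfolding h_def by (intro set_integral_add abs_integrable_continuous_mult cF cG fi gi)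
  have kint: "k integrable_on {0..a}"
    unfolding k_def using fi gi by (intro integrable_add) (auto simp: absolutely_integrable_on_def)
  have hint: "h integrable_on {0..a}" using hi by (auto simp: absolutely_integrable_on_def)
  have sub: "u integrable_on {x..y}" if "u integrable_on {0..a}" "0 \<le> x" "y \<le> a" for u :: "real \<Rightarrow> 'b::banach" and x y
    using that by (intro integrable_on_subinterval[OF that(1)]) auto
  define H where "H x = F x * G x - integral {0..x} h" for x
  have key: "norm (H x - H 0) \<le> e * integral {0..x} k" if "x \<in> {0..a}" "e > 0" for x e
  proof -
    define P where "P u v \<longleftrightarrow> (0 \<le> u \<and> u \<le> v \<and> v \<le> a \<longrightarrow> norm (H v - H u) \<le> e * integral {u..v} k)" for u v
    have "0 \<le> x" using that by simp
    then have "P 0 x"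
    proof (induction rule: Bolzano)
      case (trans u v w)
      show ?case unfolding P_def
      proof (intro impI)
        assume A: "0 \<le> u \<and> u \<le> w \<and> w \<le> a"
        have "integral {u..v} k + integral {v..w} k = integral {u..w} k"
          using A trans sub[OF kint] by (intro Henstock_Kurzweil_Integration.integral_combine) auto
        then have "e * integral {u..w} k = e * integral {u..v} k + e * integral {v..w} k"
          by (metis distrib_left)
        moreover have "norm (H v - H u) \<le> e * integral {u..v} k" "norm (H w - H v) \<le> e * integral {v..w} k"
          using trans A by (auto simp: P_def)
        moreover have "norm (H w - H u) \<le> norm (H w - H v) + norm (H v - H u)"
          by (metis diff_add_cancel norm_triangle_ineq add_diff_eq)
        ultimately show "norm (H w - H u) \<le> e * integral {u..w} k"
          by linarith
      qed
    next
      case (local s)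
      have s: "s \<in> {0..a}" using local that by auto
      obtain d1 where d1: "d1 > 0" "\<And>t. t \<in> {0..a} \<Longrightarrow> dist t s < d1 \<Longrightarrow> dist (F t) (F s) < e/2"
        using cF s \<open>e > 0\<close> unfolding continuous_on_iff by (metis half_gt_zero)
      obtain d2 where d2: "d2 > 0" "\<And>t. t \<in> {0..a} \<Longrightarrow> dist t s < d2 \<Longrightarrow> dist (G t) (G s) < e/2"
        using cG s \<open>e > 0\<close> unfolding continuous_on_iff by (metis half_gt_zero)
      have "P u v" if uv: "u \<le> s" "s \<le> v" "v - u < min d1 d2" for u v
        unfolding P_def
      proof (intro impI)
        assume A: "0 \<le> u \<and> u \<le> v \<and> v \<le> a"
        have F1: "norm (F u - F t) \<le> e" if "t \<in> {u..v}" for t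
        proof -
          have "dist (F t) (F s) < e/2" "dist (F u) (F s) < e/2"
            using that uv A by (intro d1; simp add: dist_real_def abs_less_iff; linarith?)+
          then have "dist (F u) (F t) < e" by (metis dist_triangle_half_l)
          then show ?thesis by (simp add: dist_norm)
        qed
        have G1: "norm (G v - G t) \<le> e" if "t \<in> {u..v}" for t
        proof -
          have "dist (G t) (G s) < e/2" "dist (G v) (G s) < e/2"
            using that uv A by (intro d2; simp add: dist_real_def abs_less_iff; linarith?)+
          then have "dist (G v) (G t) < e" by (metis dist_triangle_half_l)
          then show ?thesis by (simp add: dist_norm)
        qed
        have fuv: "f integrable_on {u..v}" "g integrable_on {u..v}" "h integrable_on {u..v}" "k integrable_on {u..v}"
          using A fi gi sub hint kint by (auto simp: absolutely_integrable_on_def)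
        have H1: "H v - H u = F v * G v - F u * G u - integral {u..v} h"
        proof -
          have "integral {0..u} h + integral {u..v} h = integral {0..v} h"
            using A sub[OF hint] by (intro Henstock_Kurzweil_Integration.integral_combine) auto
          then show ?thesis by (simp add: H_def algebra_simps)
        qed
        have "F v * G v - F u * G u = (F v - F u) * G v + F u * (G v - G u)"
          by (simp add: algebra_simps)
        also have "\<dots> = integral {u..v} f * G v + F u * integral {u..v} g"
          using ac_deriv_diff[OF F] ac_deriv_diff[OF G] A by simp
        also have "\<dots> = integral {u..v} (\<lambda>t. f t * G v + F u * g t)"
          using fuv by (subst integral_add) (auto intro!: integrable_on_mult_left integrable_on_mult_right)
        finally have "H v - H u = integral {u..v} (\<lambda>t. f t * G v + F u * g t) - integral {u..v} h"
          using H1 by simp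
        also have "\<dots> = integral {u..v} (\<lambda>t. (f t * G v + F u * g t) - h t)"
          using fuv by (intro integral_diff[symmetric]) (auto intro!: integrable_on_mult_left integrable_on_mult_right integrable_add)
        finally have H3: "H v - H u = integral {u..v} (\<lambda>t. (f t * G v + F u * g t) - h t)" .
        have "norm (integral {u..v} (\<lambda>t. (f t * G v + F u * g t) - h t)) \<le> integral {u..v} (\<lambda>t. e * k t)"
        proof (rule integral_norm_bound_integral)
          fix t assume t: "t \<in> {u..v}"
          have "(f t * G v + F u * g t) - h t = f t * (G v - G t) + (F u - F t) * g t"
            by (simp add: h_def algebra_simps)
          also have "norm \<dots> \<le> norm (f t) * norm (G v - G t) + norm (F u - F t) * norm (g t)"
            by (metis norm_mult norm_triangle_ineq)
          also have "\<dots> \<le> norm (f t) * e + e * norm (g t)"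
            using F1[OF t] G1[OF t] \<open>e > 0\<close> by (intro add_mono mult_mono) auto
          finally show "norm ((f t * G v + F u * g t) - h t) \<le> e * k t" by (simp add: k_def algebra_simps)
        qed (use fuv in \<open>auto intro!: integrable_on_mult_left integrable_on_mult_right integrable_add integrable_diff\<close>)
        then show "norm (H v - H u) \<le> e * integral {u..v} k" using H3 fuv by simp
      qed
      then show ?case using d1 d2 by (intro exI[of _ "min d1 d2"]) auto
    qed
    then show ?thesis using that by (auto simp: P_def)
  qed
  have Hc: "H x = H 0" if x: "x \<in> {0..a}" for x
  proof -
    have "norm (H x - H 0) \<le> 0 + e" if "e > 0" for e
    proof -
      define K where "K = \<bar>integral {0..x} k\<bar> + 1"
      have "K > 0" by (simp add: K_def)
      have "norm (H x - H 0) \<le> (e/K) * integral {0..x} k" using x that \<open>K > 0\<close> by (intro key) auto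
      also have "\<dots> \<le> (e/K) * K" using \<open>K > 0\<close> that by (intro mult_left_mono) (auto simp: K_def)
      finally show ?thesis using \<open>K > 0\<close> by simp
    qed
    then have "norm (H x - H 0) \<le> 0" by (rule field_le_epsilon)
    then show ?thesis by simp
  qed
  have "F x * G x - F 0 * G 0 = integral {0..x} h" if "0 \<le> x" "x \<le> a" for x
  proof -
    have "H x - H 0 = 0" using Hc[of x] that by simp
    then show ?thesis by (simp add: H_def algebra_simps)
  qed
  then show ?thesis using hi unfolding h_def[symmetric]
    by (intro ac_derivI)
qed

lemma ac_deriv_cong:
  assumes "ac_deriv a F f" "\<And>x. x \<in> {0..a} \<Longrightarrow> F x = G x" "\<And>x. x \<in> {0..a} \<Longrightarrow> f x = g x"
  shows "ac_deriv a G g"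
proof (rule ac_derivI)
  have "f absolutely_integrable_on {0..a} \<longleftrightarrow> g absolutely_integrable_on {0..a}"
    by (rule set_integrable_cong) (use assms(3) in auto)
  then show "g absolutely_integrable_on {0..a}" using assms(1) ac_deriv_integrable by blast
  fix x assume x: "0 \<le> x" "x \<le> a"
  have "G x - G 0 = F x - F 0" using assms(2) x by simp
  also have "\<dots> = integral {0..x} f" using ac_deriv_diff[OF assms(1), of 0 x] x by simp
  also have "\<dots> = integral {0..x} g" using x assms(3) by (intro integral_cong) auto
  finally show "G x - G 0 = integral {0..x} g" .
qed

lemma ac_deriv_cmult:
  assumes "ac_deriv a F f"
  shows "ac_deriv a (\<lambda>x. c * F x) (\<lambda>x. c * f x)"
  using ac_deriv_mult[OF ac_deriv_const assms, of c] by simp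

lemma ac_deriv_minus:
  assumes "ac_deriv a F f"
  shows "ac_deriv a (\<lambda>x. - F x) (\<lambda>x. - f x)"
  using ac_deriv_cmult[OF assms, of "-1"] by simp

lemma ac_deriv_integral:
  assumes "f absolutely_integrable_on {0..a}"
  shows "ac_deriv a (\<lambda>x. integral {0..x} f) f"
  using assms by (intro ac_derivI) auto

lemma ac_deriv_zero_imp_eq:
  assumes "ac_deriv a F f" "negligible N" "\<And>t. t \<in> {x..y} - N \<Longrightarrow> f t = 0" "0 \<le> x" "x \<le> y" "y \<le> a"
  shows "F y = F x"
proof -
  have "F y - F x = integral {x..y} f" using assms by (intro ac_deriv_diff)
  also have "\<dots> = integral {x..y} (\<lambda>_. 0)" using assms by (intro integral_spike[of N]) auto
  finally show ?thesis by simp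
qed

lemma ac_deriv_power:
  assumes "ac_deriv a F f"
  shows "ac_deriv a (\<lambda>x. F x ^ Suc n) (\<lambda>x. of_nat (Suc n) * F x ^ n * f x)"
proof (induction n)
  case 0 then show ?case using assms by simp
next
  case (Suc n)
  have "ac_deriv a (\<lambda>x. F x ^ Suc n * F x) (\<lambda>x. (of_nat (Suc n) * F x ^ n * f x) * F x + F x ^ Suc n * f x)"
    by (rule ac_deriv_mult[OF Suc assms])
  then show ?case by (rule ac_deriv_cong) (simp_all add: algebra_simps)
qed

text \<open>
  Almost every point is a point where the difference quotients of the indefinite integral converge to the integrand.
\<close>

lemma ac_deriv_zero_imp_ae_zero:
  assumes "ac_deriv a F f" "\<And>x. x \<in> {0..a} \<Longrightarrow> F x = 0"
  shows "\<exists>N. negligible N \<and> (\<forall>x\<in>{0<..<a} - N. f x = 0)"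
proof -
  have "f integrable_on {0..a}" using assms(1) by (rule ac_deriv_HK_integrable)
  define g where "g x = (if x \<in> {0..a} then f x else 0)" for x
  have gi: "g integrable_on UNIV" unfolding g_def using \<open>f integrable_on {0..a}\<close> by (simp only: integrable_restrict_UNIV)
  have "g integrable_on cbox u v" for u v :: real
    using gi by (rule integrable_on_subcbox) auto
  then obtain N where N: "negligible N"
    "\<And>x e. x \<notin> N \<Longrightarrow> 0 < e \<Longrightarrow>
        \<exists>d>0. \<forall>h. 0 < h \<and> h < d \<longrightarrow> norm (integral (cbox x (x + h *\<^sub>R One)) g /\<^sub>R h ^ DIM(real) - g x) < e"
    by (rule integrable_ccontinuous_explicit) blast
  have "f x = 0" if x: "x \<in> {0<..<a} - N" for x
  proof -
    have "norm (f x) \<le> 0 + e" if e: "e > 0" for e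
    proof -
      obtain d where d: "d > 0"
        "\<And>h. 0 < h \<Longrightarrow> h < d \<Longrightarrow> norm (integral (cbox x (x + h *\<^sub>R One)) g /\<^sub>R h ^ DIM(real) - g x) < e"
        using N(2)[of x e] x e by auto
      define h where "h = min (d/2) (a - x)"
      have h: "0 < h" "h < d" "x + h \<le> a" using d(1) x by (auto simp: h_def min_def field_simps)
      have "integral {x..x+h} g = integral {x..x+h} f"
        using x h by (intro integral_cong) (auto simp: g_def)
      also have "\<dots> = F (x+h) - F x" using x h by (intro ac_deriv_diff[OF assms(1), symmetric]) auto
      also have "\<dots> = 0" using assms(2) x h by simp
      finally have "norm (g x) < e" using d(2)[OF h(1,2)] by simp
      then show ?thesis using x by (simp add: g_def)
    qed
    then have "norm (f x) \<le> 0" by (rule field_le_epsilon)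
    then show ?thesis by simp
  qed
  then show ?thesis using N(1) by blast
qed

section \<open>Solutions, Wronskians and Volterra estimates\<close>

lemma ac_deriv_spike:
  assumes "ac_deriv a F f" "negligible N" "\<And>x. x \<in> {0..a} - N \<Longrightarrow> g x = f x"
  shows "ac_deriv a F g"
proof (rule ac_derivI)
  show "g absolutely_integrable_on {0..a}"
    using absolutely_integrable_spike[OF ac_deriv_integrable[OF assms(1)] assms(2,3)] .
  fix x assume x: "0 \<le> x" "x \<le> a"
  have "F x - F 0 = integral {0..x} f" using x by (intro ac_deriv_diff[OF assms(1)]) auto
  also have "\<dots> = integral {0..x} g" using x assms(3) by (intro integral_spike[OF assms(2)]) auto
  finally show "F x - F 0 = integral {0..x} g" .
qed

lemma L2_on_abs_integrable:
  assumes "L2_on 0 a q"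
  shows "q absolutely_integrable_on {0..a}"
proof -
  have q: "q \<in> borel_measurable (lebesgue_on {0<..<a})"
    "integrable (lebesgue_on {0<..<a}) (\<lambda>x. (norm (q x))\<^sup>2)"
    using assms by (auto simp: L2_on_def)
  have "(\<lambda>x. (norm (q x))\<^sup>2) integrable_on {0<..<a}"
    using q(2) by (intro integrable_on_lebesgue_on) auto
  moreover have "(\<lambda>x. 1::real) integrable_on {0<..<a}"
    by (metis absolutely_integrable_on_Icc_iff_Ioo absolutely_integrable_continuous_real continuous_on_const absolutely_integrable_on_def)
  ultimately have i: "(\<lambda>x. 1 + (norm (q x))\<^sup>2) integrable_on {0<..<a}"
    by (intro integrable_add)
  have "norm (q x) \<le> 1 + (norm (q x))\<^sup>2" for x
    using sum_power2_ge_zero[of "norm (q x) - 1/2" 0] by (simp add: power2_eq_square algebra_simps)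
  then have "q absolutely_integrable_on {0<..<a}"
    using measurable_bounded_by_integrable_imp_absolutely_integrable[OF q(1) _ i] by auto
  then show ?thesis by (simp add: absolutely_integrable_on_Icc_iff_Ioo)
qed

text \<open>
  The first order system \<open>y' = dy\<close>, \<open>dy' = (q - \<mu>) y\<close>.  The spectral parameter is \<open>\<mu> = l\<^sup>2\<close>, so that solutions
  with initial data independent of \<open>l\<close> are visibly even in \<open>l\<close>.
\<close>

definition SL_sol :: "real \<Rightarrow> (real \<Rightarrow> complex) \<Rightarrow> complex \<Rightarrow> (real \<Rightarrow> complex) \<Rightarrow> (real \<Rightarrow> complex) \<Rightarrow> bool" where
  "SL_sol a q \<mu> y dy \<longleftrightarrow> ac_deriv a y dy \<and> ac_deriv a dy (\<lambda>t. (q t - \<mu>) * y t)"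

lemma SL_solution_imp_SL_sol:
  assumes "SL_solution a q l y dy"
  shows "SL_sol a q (l\<^sup>2) y dy"
proof -
  obtain ddy where d: "integrable (lebesgue_on {0..a}) ddy"
    "\<forall>x\<in>{0..a}. dy x = dy 0 + (LINT t|lebesgue_on {0..x}. ddy t)"
    "AE x in lebesgue_on {0<..<a}. - ddy x + q x * y x = l\<^sup>2 * y x"
    and y: "\<forall>x\<in>{0..a}. (y has_vector_derivative dy x) (at x within {0..a})"
    using assms unfolding SL_solution_def by blast
  have 1: "ac_deriv a dy ddy"
  proof (rule ac_derivI)
    show "ddy absolutely_integrable_on {0..a}"
      using d(1) by (simp add: set_integrable_def integrable_restrict_space)
    fix x assume x: "0 \<le> x" "x \<le> a"
    have "integrable (lebesgue_on {0..x}) ddy"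
      using d(1) x by (intro Equivalence_Lebesgue_Henstock_Integration.integrable_subinterval[OF d(1)]) auto
    then have "(LINT t|lebesgue_on {0..x}. ddy t) = integral {0..x} ddy"
      by (intro lebesgue_integral_eq_integral) auto
    moreover have "dy x = dy 0 + (LINT t|lebesgue_on {0..x}. ddy t)"
      using d(2) x by (meson atLeastAtMost_iff)
    ultimately show "dy x - dy 0 = integral {0..x} ddy" by (metis add_diff_cancel_left')
  qed
  have "AE x in lebesgue. x \<in> {0<..<a} \<longrightarrow> - ddy x + q x * y x = l\<^sup>2 * y x"
    using d(3) by (subst (asm) AE_restrict_space_iff) auto
  then obtain N where N: "negligible N" "{x. \<not> (x \<in> {0<..<a} \<longrightarrow> - ddy x + q x * y x = l\<^sup>2 * y x)} \<subseteq> N"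
    unfolding eventually_ae_filter_negligible by blast
  have "ac_deriv a dy (\<lambda>t. (q t - l\<^sup>2) * y t)"
  proof (rule ac_deriv_spike[OF 1])
    show "negligible (insert 0 (insert a N))" using N(1) by simp
    fix x assume x: "x \<in> {0..a} - insert 0 (insert a N)"
    then have "x \<in> {0<..<a}" "x \<notin> N" by auto
    then have "- ddy x + q x * y x = l\<^sup>2 * y x" using N(2) by blast
    then have "q x * y x - l\<^sup>2 * y x = ddy x" by (metis add.commute diff_add_eq_diff_diff_swap diff_minus_eq_add diff_self add_0)
    then show "(q x - l\<^sup>2) * y x = ddy x" by (simp only: left_diff_distrib)
  qed
  moreover have "ac_deriv a y dy"
    using y ac_deriv_continuous[OF 1] by (intro ac_deriv_C1) auto
  ultimately show ?thesis by (simp add: SL_sol_def)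
qed

lemma SL_sol_subinterval: "SL_sol a q \<mu> y dy \<Longrightarrow> b \<le> a \<Longrightarrow> SL_sol b q \<mu> y dy"
  by (auto simp: SL_sol_def intro: ac_deriv_subinterval)

lemma SL_sol_lincomb:
  assumes "SL_sol a q \<mu> y dy" "SL_sol a q \<mu> z dz"
  shows "SL_sol a q \<mu> (\<lambda>x. A * y x + B * z x) (\<lambda>x. A * dy x + B * dz x)"
proof -
  have "ac_deriv a (\<lambda>x. A * y x + B * z x) (\<lambda>x. A * dy x + B * dz x)"
    using assms by (intro ac_deriv_add ac_deriv_cmult) (auto simp: SL_sol_def)
  moreover have "ac_deriv a (\<lambda>x. A * dy x + B * dz x) (\<lambda>x. A * ((q x - \<mu>) * y x) + B * ((q x - \<mu>) * z x))"
    using assms by (intro ac_deriv_add ac_deriv_cmult) (auto simp: SL_sol_def)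
  then have "ac_deriv a (\<lambda>x. A * dy x + B * dz x) (\<lambda>x. (q x - \<mu>) * (A * y x + B * z x))"
    by (rule ac_deriv_cong) (auto simp: algebra_simps)
  ultimately show ?thesis by (simp add: SL_sol_def)
qed

lemma wronskian_ac_deriv:
  assumes "SL_sol a q \<mu> y dy" "SL_sol a p \<mu> z dz"
  shows "ac_deriv a (\<lambda>x. y x * dz x - dy x * z x) (\<lambda>x. (p x - q x) * (y x * z x))"
proof -
  have "ac_deriv a (\<lambda>x. y x * dz x + - (dy x * z x))
     (\<lambda>x. (dy x * dz x + y x * ((p x - \<mu>) * z x)) + - (((q x - \<mu>) * y x) * z x + dy x * dz x))"
    using assms unfolding SL_sol_def by (intro ac_deriv_add ac_deriv_minus ac_deriv_mult) auto
  then show ?thesis by (rule ac_deriv_cong) (auto simp: algebra_simps)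
qed

lemma wronskian_const:
  assumes "SL_sol a q \<mu> y dy" "SL_sol a q \<mu> z dz" "x \<in> {0..a}" "c \<in> {0..a}"
  shows "y x * dz x - dy x * z x = y c * dz c - dy c * z c"
proof -
  have "y u * dz u - dy u * z u = y 0 * dz 0 - dy 0 * z 0" if "u \<in> {0..a}" for u
    using that by (intro ac_deriv_zero_imp_eq[OF wronskian_ac_deriv[OF assms(1,2)], of "{}"]) auto
  then show ?thesis using assms(3,4) by metis
qed

text \<open>
  Wronskians with the fundamental system are constant, and their values at the base point \<open>c\<close> are the coefficients.
  In particular a solution is determined by its data at \<open>c\<close>.
\<close>

lemma SL_sol_expand:
  assumes y: "SL_sol a q \<mu> y dy" and C: "SL_sol a q \<mu> C dC" and S: "SL_sol a q \<mu> S dS"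
    and c: "c \<in> {0..a}" "C c = 1" "dC c = 0" "S c = 0" "dS c = 1" and x: "x \<in> {0..a}"
  shows "y x = y c * C x + dy c * S x" "dy x = y c * dC x + dy c * dS x"
proof -
  have 1: "C x * dS x - dC x * S x = 1" using wronskian_const[OF C S x c(1)] c by simp
  have 2: "y x * dS x - dy x * S x = y c" using wronskian_const[OF y S x c(1)] c by simp
  have 3: "C x * dy x - dC x * y x = dy c" using wronskian_const[OF C y x c(1)] c by simp
  have "y c * C x + dy c * S x = y x * (C x * dS x - dC x * S x)"
    unfolding 2[symmetric] 3[symmetric] by (simp add: algebra_simps)
  then show "y x = y c * C x + dy c * S x" by (simp add: 1)
  have "y c * dC x + dy c * dS x = dy x * (C x * dS x - dC x * S x)"
    unfolding 2[symmetric] 3[symmetric] by (simp add: algebra_simps)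
  then show "dy x = y c * dC x + dy c * dS x" by (simp add: 1)
qed

lemma norm_sin_le_exp_Im: "norm (sin z) \<le> exp \<bar>Im z\<bar>"
  using cmod_sin_le_exp[of 1 z] by simp

lemma norm_cos_le_exp_Im: "norm (cos z) \<le> exp \<bar>Im z\<bar>"
  using cmod_cos_le_exp[of 1 z] by simp

text \<open>
  Variation of constants: for fixed \<open>x\<close> this function of \<open>t\<close> has the value \<open>y x\<close> at \<open>t = x\<close>, and at a base point
  \<open>t = c\<close> it is the solution of the equation without potential that has the same data as \<open>y\<close> at \<open>c\<close>.
\<close>

lemma SL_sol_volterra_ac_deriv:
  assumes y: "SL_sol a q (l\<^sup>2) y dy" and l: "l \<noteq> 0"
  shows "ac_deriv a (\<lambda>t. dy t * (sin (l * of_real (x - t)) / l) + y t * cos (l * of_real (x - t)))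
           (\<lambda>t. q t * y t * (sin (l * of_real (x - t)) / l))"
proof -
  have s: "ac_deriv a (\<lambda>t. sin (l * of_real (x - t)) / l) (\<lambda>t. - cos (l * of_real (x - t)))"
  proof (rule ac_deriv_C1)
    fix t
    have "((\<lambda>t. sin (l * (of_real x - of_real t)) / l) has_vector_derivative - cos (l * (of_real x - of_real t))) (at t within {0..a})"
      using l by (intro has_vector_derivative_real_field) (auto intro!: derivative_eq_intros simp: field_simps)
    then show "((\<lambda>t. sin (l * of_real (x - t)) / l) has_vector_derivative - cos (l * of_real (x - t))) (at t within {0..a})"
      by simp
  qed (auto intro!: continuous_intros)
  have c: "ac_deriv a (\<lambda>t. cos (l * of_real (x - t))) (\<lambda>t. l * sin (l * of_real (x - t)))"
  proof (rule ac_deriv_C1)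
    fix t
    have "((\<lambda>t. cos (l * (of_real x - of_real t))) has_vector_derivative l * sin (l * (of_real x - of_real t))) (at t within {0..a})"
      by (intro has_vector_derivative_real_field) (auto intro!: derivative_eq_intros simp: field_simps)
    then show "((\<lambda>t. cos (l * of_real (x - t))) has_vector_derivative l * sin (l * of_real (x - t))) (at t within {0..a})"
      by simp
  qed (auto intro!: continuous_intros)
  have "ac_deriv a (\<lambda>t. dy t * (sin (l * of_real (x - t)) / l) + y t * cos (l * of_real (x - t)))
    (\<lambda>t. (((q t - l\<^sup>2) * y t) * (sin (l * of_real (x - t)) / l) + dy t * (- cos (l * of_real (x - t))))
       + (dy t * cos (l * of_real (x - t)) + y t * (l * sin (l * of_real (x - t)))))"
    using y s c unfolding SL_sol_def by (intro ac_deriv_add ac_deriv_mult) auto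
  then show ?thesis
    by (rule ac_deriv_cong) (use l in \<open>auto simp: field_simps power2_eq_square\<close>)
qed

lemma abs_integrable_norm_mono:
  fixes q :: "real \<Rightarrow> complex"
  assumes "q absolutely_integrable_on {0..a}" "0 \<le> u" "v \<le> a" "u \<le> v"
  shows "integral {u..v} (\<lambda>t. norm (q t)) \<le> integral {0..a} (\<lambda>t. norm (q t))"
    "(\<lambda>t. norm (q t)) integrable_on {u..v}"
proof -
  have 1: "(\<lambda>t. norm (q t)) integrable_on {0..a}" using assms by (simp add: absolutely_integrable_on_def)
  then show 2: "(\<lambda>t. norm (q t)) integrable_on {u..v}"
    using assms by (intro integrable_on_subinterval[OF 1]) auto
  show "integral {u..v} (\<lambda>t. norm (q t)) \<le> integral {0..a} (\<lambda>t. norm (q t))"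
    using assms 1 2 by (intro integral_subset_le) auto
qed

text \<open>
  The exponential weight is compatible with the kernel: for \<open>t\<close> between \<open>c\<close> and \<open>x\<close> the growth of \<open>y\<close> from \<open>c\<close> to \<open>t\<close>
  and that of the kernel from \<open>t\<close> to \<open>x\<close> multiply to the growth from \<open>c\<close> to \<open>x\<close>.
\<close>

lemma SL_sol_volterra:
  assumes y: "SL_sol a q (l\<^sup>2) y dy" and q: "q absolutely_integrable_on {0..a}" and l: "l \<noteq> 0"
    and c: "c \<in> {0..a}" and x: "x \<in> {0..a}"
    and M: "\<And>t. t \<in> {0..a} \<Longrightarrow> norm (y t) \<le> M * exp (\<bar>Im l\<bar> * \<bar>t - c\<bar>)"
  shows "norm (y x - (dy c * (sin (l * of_real (x - c)) / l) + y c * cos (l * of_real (x - c))))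
     \<le> M * exp (\<bar>Im l\<bar> * \<bar>x - c\<bar>) * integral {0..a} (\<lambda>t. norm (q t)) / norm l"
proof -
  define G where "G t = dy t * (sin (l * of_real (x - t)) / l) + y t * cos (l * of_real (x - t))" for t
  define g where "g t = q t * y t * (sin (l * of_real (x - t)) / l)" for t
  have ac: "ac_deriv a G g" unfolding G_def g_def by (rule SL_sol_volterra_ac_deriv[OF y l])
  have Gx: "G x = y x" by (simp add: G_def)
  define u v where "u = min c x" and "v = max c x"
  have uv: "0 \<le> u" "u \<le> v" "v \<le> a" using c x by (auto simp: u_def v_def)
  define B where "B = M * exp (\<bar>Im l\<bar> * \<bar>x - c\<bar>) / norm l"
  have "0 \<le> M * exp (\<bar>Im l\<bar> * \<bar>c - c\<bar>)" using M[OF c] norm_ge_zero order_trans by blast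
  then have M0: "M \<ge> 0" by simp
  have "norm (y x - G c) = norm (G v - G u)"
    by (cases "c \<le> x") (auto simp: u_def v_def Gx norm_minus_commute max_def min_def)
  also have "\<dots> = norm (integral {u..v} g)" using ac_deriv_diff[OF ac uv] by simp
  also have "\<dots> \<le> integral {u..v} (\<lambda>t. norm (q t) * B)"
  proof (rule integral_norm_bound_integral)
    show "g integrable_on {u..v}"
      using ac_deriv_HK_integrable[OF ac] uv by (intro integrable_on_subinterval[OF ac_deriv_HK_integrable[OF ac]]) auto
    show "(\<lambda>t. norm (q t) * B) integrable_on {u..v}"
      using abs_integrable_norm_mono(2)[OF q uv(1,3,2)] by (rule integrable_on_mult_left)
    fix t assume t: "t \<in> {u..v}"
    have tt: "\<bar>t - c\<bar> + \<bar>x - t\<bar> = \<bar>x - c\<bar>" using t by (auto simp: u_def v_def min_def max_def split: if_splits)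
    have "norm (g t) = norm (q t) * (norm (y t) * norm (sin (l * of_real (x - t))) / norm l)"
      by (simp add: g_def norm_mult norm_divide)
    also have "\<dots> \<le> norm (q t) * ((M * exp (\<bar>Im l\<bar> * \<bar>t - c\<bar>)) * exp (\<bar>Im l\<bar> * \<bar>x - t\<bar>) / norm l)"
    proof (intro mult_left_mono divide_right_mono mult_mono)
      show "norm (y t) \<le> M * exp (\<bar>Im l\<bar> * \<bar>t - c\<bar>)" using t uv by (intro M) auto
      show "norm (sin (l * of_real (x - t))) \<le> exp (\<bar>Im l\<bar> * \<bar>x - t\<bar>)"
        using norm_sin_le_exp_Im[of "l * of_real (x - t)"] by (simp add: abs_mult)
    qed (use M0 in auto)
    also have "\<dots> = norm (q t) * B"
      unfolding B_def tt[symmetric] by (simp add: exp_add distrib_left)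
    finally show "norm (g t) \<le> norm (q t) * B" .
  qed
  also have "\<dots> = integral {u..v} (\<lambda>t. norm (q t)) * B" by simp
  also have "\<dots> \<le> integral {0..a} (\<lambda>t. norm (q t)) * B"
    using abs_integrable_norm_mono(1)[OF q uv(1,3,2)] M0 by (intro mult_right_mono) (auto simp: B_def)
  finally show ?thesis by (simp add: G_def B_def mult_ac)
qed

text \<open>
  Let \<open>M\<close> be the maximum of \<open>|y|\<close> divided by the weight.  At the point where it is attained, the Volterra equation
  gives \<open>M \<le> A + M/2\<close> as soon as \<open>|l|\<close> is at least twice the integral of \<open>|q|\<close>.
\<close>

lemma SL_sol_bound:
  assumes y: "SL_sol a q (l\<^sup>2) y dy" and q: "q absolutely_integrable_on {0..a}" and l: "l \<noteq> 0"
    and lK: "norm l \<ge> 2 * integral {0..a} (\<lambda>t. norm (q t))"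
    and c: "c \<in> {0..a}" and x: "x \<in> {0..a}"
  shows "norm (y x) \<le> 2 * (norm (y c) + norm (dy c) / norm l) * exp (\<bar>Im l\<bar> * \<bar>x - c\<bar>)"
proof -
  define \<tau> where "\<tau> = \<bar>Im l\<bar>"
  define u where "u t = exp (- \<tau> * \<bar>t - c\<bar>) * norm (y t)" for t
  define K where "K = integral {0..a} (\<lambda>t. norm (q t))"
  have "continuous_on {0..a} y" using y ac_deriv_continuous by (auto simp: SL_sol_def)
  then have cu: "continuous_on {0..a} u" unfolding u_def by (intro continuous_intros)
  have "compact {0..a}" "{0..a} \<noteq> {}" using x by auto
  from continuous_attains_sup[OF this cu]
  obtain s where s: "s \<in> {0..a}" "\<And>t. t \<in> {0..a} \<Longrightarrow> u t \<le> u s" by metis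
  have ub: "norm (y t) = u t * exp (\<tau> * \<bar>t - c\<bar>)" for t
    by (simp add: u_def exp_minus)
  have M: "norm (y t) \<le> u s * exp (\<tau> * \<bar>t - c\<bar>)" if "t \<in> {0..a}" for t
    unfolding ub by (intro mult_right_mono s that) auto
  define A where "A = norm (y c) + norm (dy c) / norm l"
  define V where "V = dy c * (sin (l * of_real (s - c)) / l) + y c * cos (l * of_real (s - c))"
  have "norm (y s - V) \<le> u s * exp (\<tau> * \<bar>s - c\<bar>) * K / norm l"
    unfolding V_def \<tau>_def K_def by (rule SL_sol_volterra[OF y q l c s(1)]) (use M in \<open>auto simp: \<tau>_def\<close>)
  also have "\<dots> = u s * exp (\<tau> * \<bar>s - c\<bar>) * (K / norm l)" by simp
  also have "\<dots> \<le> u s * exp (\<tau> * \<bar>s - c\<bar>) * (1/2)"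
    using lK l by (intro mult_left_mono) (auto simp: K_def field_simps u_def)
  finally have 1: "norm (y s - V) \<le> u s * exp (\<tau> * \<bar>s - c\<bar>) / 2" by simp
  have "norm V \<le> norm (dy c) / norm l * norm (sin (l * of_real (s - c))) + norm (y c) * norm (cos (l * of_real (s - c)))"
    unfolding V_def by (rule norm_triangle_le) (simp add: norm_mult norm_divide)
  also have "\<dots> \<le> norm (dy c) / norm l * exp (\<tau> * \<bar>s - c\<bar>) + norm (y c) * exp (\<tau> * \<bar>s - c\<bar>)"
    using norm_sin_le_exp_Im[of "l * of_real (s - c)"] norm_cos_le_exp_Im[of "l * of_real (s - c)"]
    by (intro add_mono mult_left_mono) (auto simp: abs_mult \<tau>_def)
  also have "\<dots> = A * exp (\<tau> * \<bar>s - c\<bar>)" by (simp add: A_def algebra_simps)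
  finally have 2: "norm V \<le> A * exp (\<tau> * \<bar>s - c\<bar>)" .
  have "u s * exp (\<tau> * \<bar>s - c\<bar>) \<le> A * exp (\<tau> * \<bar>s - c\<bar>) + u s * exp (\<tau> * \<bar>s - c\<bar>) / 2"
    using 1 2 norm_triangle_sub[of "y s" V] by (simp add: ub[symmetric])
  then have "exp (\<tau> * \<bar>s - c\<bar>) * (u s / 2) \<le> exp (\<tau> * \<bar>s - c\<bar>) * A" by argo
  then have "u s / 2 \<le> A" by (metis mult_le_cancel_left_pos exp_gt_zero)
  then have "u s \<le> 2 * A" by linarith
  then have "u s * exp (\<tau> * \<bar>x - c\<bar>) \<le> 2 * A * exp (\<tau> * \<bar>x - c\<bar>)" by (intro mult_right_mono) auto
  from order_trans[OF M[OF x] this] show ?thesis by (simp only: A_def \<tau>_def)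
qed

section \<open>Existence and analyticity in the spectral parameter\<close>

text \<open>
  Terms of the series solution: the zeroth is the affine function with the prescribed data, and the second derivative of each
  further term is \<open>q - \<mu>\<close> times its predecessor.
\<close>

primrec picard :: "(real \<Rightarrow> complex) \<Rightarrow> complex \<Rightarrow> complex \<Rightarrow> complex \<Rightarrow> nat \<Rightarrow> real \<Rightarrow> complex" where
  "picard q A B \<mu> 0 = (\<lambda>x. A + B * of_real x)"
| "picard q A B \<mu> (Suc n) = (\<lambda>x. integral {0..x} (\<lambda>s. integral {0..s} (\<lambda>t. (q t - \<mu>) * picard q A B \<mu> n t)))"

definition dpicard :: "(real \<Rightarrow> complex) \<Rightarrow> complex \<Rightarrow> complex \<Rightarrow> complex \<Rightarrow> nat \<Rightarrow> real \<Rightarrow> complex" where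
  "dpicard q A B \<mu> n x = (case n of 0 \<Rightarrow> B | Suc k \<Rightarrow> integral {0..x} (\<lambda>t. (q t - \<mu>) * picard q A B \<mu> k t))"

lemma abs_integrable_minus_const:
  fixes q :: "real \<Rightarrow> complex"
  assumes "q absolutely_integrable_on {0..a}"
  shows "(\<lambda>t. q t - \<mu>) absolutely_integrable_on {0..a}"
  using assms by (intro set_integral_diff(1)[OF assms] absolutely_integrable_continuous_real) auto

lemma picard_ac_deriv:
  assumes q: "q absolutely_integrable_on {0..a}"
  shows "ac_deriv a (picard q A B \<mu> n) (dpicard q A B \<mu> n)"
    "ac_deriv a (dpicard q A B \<mu> (Suc n)) (\<lambda>t. (q t - \<mu>) * picard q A B \<mu> n t)"
proof -
  have *: "ac_deriv a (dpicard q A B \<mu> (Suc n)) (\<lambda>t. (q t - \<mu>) * picard q A B \<mu> n t)"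
    if "ac_deriv a (picard q A B \<mu> n) (dpicard q A B \<mu> n)" for n
  proof -
    have "(\<lambda>t. (q t - \<mu>) * picard q A B \<mu> n t) absolutely_integrable_on {0..a}"
      by (intro abs_integrable_continuous_mult(2) ac_deriv_continuous[OF that] abs_integrable_minus_const q)
    then show ?thesis by (simp add: dpicard_def[abs_def] ac_deriv_integral)
  qed
  have 1: "ac_deriv a (picard q A B \<mu> n) (dpicard q A B \<mu> n)" for n
  proof (induction n)
    case 0
    have "ac_deriv a (\<lambda>x. A + B * of_real x) (\<lambda>x. B)"
    proof (rule ac_deriv_C1)
      fix x
      show "((\<lambda>x. A + B * of_real x) has_vector_derivative B) (at x within {0..a})"
        by (auto intro!: derivative_eq_intros has_vector_derivative_real_field)
    qed auto
    then show ?case by (simp add: dpicard_def[abs_def])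
  next
    case (Suc n)
    have "continuous_on {0..a} (dpicard q A B \<mu> (Suc n))" by (rule ac_deriv_continuous[OF *[OF Suc]])
    then have "ac_deriv a (\<lambda>x. integral {0..x} (dpicard q A B \<mu> (Suc n))) (dpicard q A B \<mu> (Suc n))"
      by (intro ac_deriv_integral absolutely_integrable_continuous_real)
    then show ?case by (simp add: dpicard_def[abs_def])
  qed
  show "ac_deriv a (picard q A B \<mu> n) (dpicard q A B \<mu> n)" by (rule 1)
  show "ac_deriv a (dpicard q A B \<mu> (Suc n)) (\<lambda>t. (q t - \<mu>) * picard q A B \<mu> n t)" by (rule *[OF 1])
qed

text \<open>
  The integrand bounds \<open>|q - \<mu>|\<close> for all \<open>|\<mu>| \<le> R\<close> at once; up to a constant and the factor \<open>a\<^sup>n\<close>, the \<open>n\<close>-th term of the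
  series is dominated by the \<open>n\<close>-th power of this weight divided by \<open>n!\<close>.
\<close>

definition picard_weight :: "(real \<Rightarrow> complex) \<Rightarrow> real \<Rightarrow> real \<Rightarrow> real" where
  "picard_weight q R x = integral {0..x} (\<lambda>t. norm (q t) + R)"

lemma picard_weight_ac_deriv:
  assumes "q absolutely_integrable_on {0..a}"
  shows "ac_deriv a (picard_weight q R) (\<lambda>t. norm (q t) + R)"
  unfolding picard_weight_def using assms
  by (intro ac_deriv_integral set_integral_add(1)[OF absolutely_integrable_norm[unfolded o_def]]
      absolutely_integrable_continuous_real[where f = "\<lambda>_. R"]) auto

lemma picard_weight_nonneg:
  assumes "R \<ge> 0"
  shows "picard_weight q R x \<ge> 0"
  unfolding picard_weight_def
  by (cases "(\<lambda>t. norm (q t) + R) integrable_on {0..x}")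
     (use assms in \<open>auto intro!: integral_nonneg simp: not_integrable_integral\<close>)

lemma picard_weight_mono:
  assumes "q absolutely_integrable_on {0..a}" "R \<ge> 0" "0 \<le> x" "x \<le> y" "y \<le> a"
  shows "picard_weight q R x \<le> picard_weight q R y"
proof -
  have ac: "ac_deriv a (picard_weight q R) (\<lambda>t. norm (q t) + R)" by (rule picard_weight_ac_deriv[OF assms(1)])
  have "picard_weight q R y - picard_weight q R x = integral {x..y} (\<lambda>t. norm (q t) + R)"
    by (rule ac_deriv_diff[OF ac assms(3-5)])
  also have "\<dots> \<ge> 0"
    using assms ac_deriv_HK_integrable[OF ac]
    by (intro integral_nonneg integrable_on_subinterval[OF ac_deriv_HK_integrable[OF ac]]) auto
  finally show ?thesis by simp
qed

text \<open>
  The bound is propagated because \<open>w\<^sup>n / n!\<close> times the derivative of \<open>w\<close> is the derivative of the next such term.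
\<close>

lemma picard_bound_step:
  assumes q: "q absolutely_integrable_on {0..a}" and \<mu>: "norm \<mu> \<le> R" and x: "0 \<le> x" "x \<le> a" and C: "C \<ge> 0"
    and b: "\<And>t. t \<in> {0..a} \<Longrightarrow> norm (picard q A B \<mu> n t) \<le> C * picard_weight q R t ^ n / fact n"
  shows "norm (dpicard q A B \<mu> (Suc n) x) \<le> C * picard_weight q R x ^ Suc n / fact (Suc n)"
proof -
  define w where "w = picard_weight q R"
  have R: "R \<ge> 0" using \<mu> norm_ge_zero order_trans by blast
  have acw: "ac_deriv a w (\<lambda>t. norm (q t) + R)" unfolding w_def by (rule picard_weight_ac_deriv[OF q])
  have acwn: "ac_deriv a (\<lambda>x. C / fact (Suc n) * w x ^ Suc n)
     (\<lambda>x. C / fact (Suc n) * (of_nat (Suc n) * w x ^ n * (norm (q x) + R)))"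
    by (rule ac_deriv_cmult[OF ac_deriv_power[OF acw]])
  note acp = picard_ac_deriv[OF q, of A B \<mu> n]
  have "norm (dpicard q A B \<mu> (Suc n) x) = norm (integral {0..x} (\<lambda>t. (q t - \<mu>) * picard q A B \<mu> n t))"
    by (simp add: dpicard_def)
  also have "\<dots> \<le> integral {0..x} (\<lambda>x. C / fact (Suc n) * (of_nat (Suc n) * w x ^ n * (norm (q x) + R)))"
  proof (rule integral_norm_bound_integral)
    show "(\<lambda>t. (q t - \<mu>) * picard q A B \<mu> n t) integrable_on {0..x}"
      using x by (intro ac_deriv_HK_integrable[OF ac_deriv_subinterval[OF acp(2)]]) auto
    show "(\<lambda>x. C / fact (Suc n) * (of_nat (Suc n) * w x ^ n * (norm (q x) + R))) integrable_on {0..x}"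
      using x by (intro ac_deriv_HK_integrable[OF ac_deriv_subinterval[OF acwn]]) auto
    fix t assume t: "t \<in> {0..x}"
    have "norm ((q t - \<mu>) * picard q A B \<mu> n t) \<le> (norm (q t) + R) * (C * w t ^ n / fact n)"
      unfolding norm_mult
    proof (rule mult_mono)
      show "norm (q t - \<mu>) \<le> norm (q t) + R" using \<mu> norm_triangle_ineq4[of "q t" \<mu>] by linarith
      show "norm (picard q A B \<mu> n t) \<le> C * w t ^ n / fact n" using b[of t] t x by (simp add: w_def)
    qed (use R in auto)
    also have "\<dots> = C / fact (Suc n) * (of_nat (Suc n) * w t ^ n * (norm (q t) + R))"
      by (simp add: field_simps del: of_nat_Suc)
    finally show "norm ((q t - \<mu>) * picard q A B \<mu> n t) \<le> C / fact (Suc n) * (of_nat (Suc n) * w t ^ n * (norm (q t) + R))" .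
  qed
  also have "\<dots> = C / fact (Suc n) * w x ^ Suc n - C / fact (Suc n) * w 0 ^ Suc n"
    using ac_deriv_diff[OF acwn, of 0 x] x by simp
  also have "w 0 = 0" by (simp add: w_def picard_weight_def)
  finally show ?thesis by (simp add: w_def)
qed

lemma picard_bound:
  assumes q: "q absolutely_integrable_on {0..a}" and \<mu>: "norm \<mu> \<le> R" and x: "x \<in> {0..a}"
  shows "norm (picard q A B \<mu> n x) \<le> (norm A + norm B * a) * a ^ n * picard_weight q R x ^ n / fact n"
  using x
proof (induction n arbitrary: x)
  case (0 x)
  have "norm (picard q A B \<mu> 0 x) \<le> norm A + norm B * norm x"
    by (simp add: norm_triangle_le norm_mult)
  also have "\<dots> \<le> norm A + norm B * a" using 0 by (intro add_left_mono mult_left_mono) auto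
  finally show ?case by simp
next
  case (Suc n x)
  define C where "C = (norm A + norm B * a) * a ^ n"
  have R: "R \<ge> 0" using \<mu> norm_ge_zero order_trans by blast
  have a: "a \<ge> 0" using Suc.prems by auto
  then have C: "C \<ge> 0" by (simp add: C_def)
  define K where "K = C * picard_weight q R x ^ Suc n / fact (Suc n)"
  have d: "norm (dpicard q A B \<mu> (Suc n) t) \<le> K" if "t \<in> {0..x}" for t
  proof -
    have "norm (dpicard q A B \<mu> (Suc n) t) \<le> C * picard_weight q R t ^ Suc n / fact (Suc n)"
      using Suc that C by (intro picard_bound_step[OF q \<mu>]) (auto simp: C_def)
    also have "\<dots> \<le> K" unfolding K_def
      using that Suc.prems C R
      by (intro divide_right_mono mult_left_mono power_mono picard_weight_mono[OF q] picard_weight_nonneg) auto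
    finally show ?thesis .
  qed
  have "picard q A B \<mu> (Suc n) 0 = 0" by simp
  then have "norm (picard q A B \<mu> (Suc n) x) = norm (picard q A B \<mu> (Suc n) x - picard q A B \<mu> (Suc n) 0)" by simp
  also have "\<dots> = norm (integral {0..x} (dpicard q A B \<mu> (Suc n)))"
    using Suc.prems by (subst ac_deriv_diff[OF picard_ac_deriv(1)[OF q]]) auto
  also have "\<dots> \<le> K * (x - 0)"
  proof (rule integral_bound)
    have "continuous_on {0..a} (dpicard q A B \<mu> (Suc n))" by (rule ac_deriv_continuous[OF picard_ac_deriv(2)[OF q]])
    then show "continuous_on {0..x} (dpicard q A B \<mu> (Suc n))" using Suc.prems by (auto intro: continuous_on_subset)
  qed (use d Suc.prems in auto)
  also have "\<dots> \<le> K * a"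
    using Suc.prems C picard_weight_nonneg[OF R, of q x] by (intro mult_left_mono) (auto simp: K_def)
  finally show ?case by (simp add: K_def C_def mult_ac)
qed

lemma dpicard_bound:
  assumes q: "q absolutely_integrable_on {0..a}" and \<mu>: "norm \<mu> \<le> R" and x: "x \<in> {0..a}" and a: "a > 0"
  shows "norm (dpicard q A B \<mu> n x) \<le> (norm A + norm B * a) / a * a ^ n * picard_weight q R x ^ n / fact n"
proof (cases n)
  case 0
  then show ?thesis using a by (simp add: dpicard_def field_simps)
next
  case (Suc k)
  have "norm (dpicard q A B \<mu> (Suc k) x) \<le> ((norm A + norm B * a) * a ^ k) * picard_weight q R x ^ Suc k / fact (Suc k)"
    using x a by (intro picard_bound_step[OF q \<mu>] picard_bound[OF q \<mu>]) auto
  then show ?thesis using a Suc by simp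
qed

lemma summable_exp_weighted: "summable (\<lambda>n. (C::real) * b ^ n * w ^ n / fact n)"
proof -
  have "summable (\<lambda>n. C * (inverse (fact n) * (b * w) ^ n))"
    by (intro summable_mult summable_exp)
  then show ?thesis by (simp add: power_mult_distrib field_simps)
qed

text \<open>
  A common bound, uniform in \<open>x \<in> [0,a]\<close> and \<open>|\<mu>| \<le> R\<close>, for the Picard terms and their derivatives.
\<close>

definition picard_majorant :: "(real \<Rightarrow> complex) \<Rightarrow> complex \<Rightarrow> complex \<Rightarrow> real \<Rightarrow> real \<Rightarrow> nat \<Rightarrow> real" where
  "picard_majorant q A B a R n = ((norm A + norm B * a) + (norm A + norm B * a) / a) * a ^ n * picard_weight q R a ^ n / fact n"

lemma picard_majorant_summable: "summable (picard_majorant q A B a R)"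
  unfolding picard_majorant_def by (rule summable_exp_weighted)

lemma picard_le_bd:
  assumes q: "q absolutely_integrable_on {0..a}" and \<mu>: "norm \<mu> \<le> R" and x: "x \<in> {0..a}" and a: "a > 0"
  shows "norm (picard q A B \<mu> n x) \<le> picard_majorant q A B a R n" "norm (dpicard q A B \<mu> n x) \<le> picard_majorant q A B a R n"
proof -
  have R: "R \<ge> 0" using \<mu> norm_ge_zero order_trans by blast
  have m: "c * a ^ n * picard_weight q R x ^ n / fact n \<le> picard_majorant q A B a R n"
    if "c \<le> (norm A + norm B * a) + (norm A + norm B * a) / a" for c
    unfolding picard_majorant_def using that x a R
    by (intro divide_right_mono mult_mono power_mono picard_weight_mono[OF q] picard_weight_nonneg zero_le_power) auto
  show "norm (picard q A B \<mu> n x) \<le> picard_majorant q A B a R n"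
    using a by (intro order_trans[OF picard_bound[OF q \<mu> x] m]) auto
  show "norm (dpicard q A B \<mu> n x) \<le> picard_majorant q A B a R n"
    using a by (intro order_trans[OF dpicard_bound[OF q \<mu> x a] m]) auto
qed

lemma ac_deriv_limit:
  fixes f :: "nat \<Rightarrow> real \<Rightarrow> complex"
  assumes ac: "\<And>n. ac_deriv a (F n) (f n)" and h: "h integrable_on {0..a}"
    and le: "\<And>n x. x \<in> {0..a} \<Longrightarrow> norm (f n x) \<le> h x"
    and lf: "\<And>x. x \<in> {0..a} \<Longrightarrow> (\<lambda>n. f n x) \<longlonglongrightarrow> g x"
    and lF: "\<And>x. x \<in> {0..a} \<Longrightarrow> (\<lambda>n. F n x) \<longlonglongrightarrow> G x"
  shows "ac_deriv a G g"
proof (rule ac_derivI)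
  have "norm (g x) \<le> h x" if "x \<in> {0..a}" for x
    using le[OF that] by (intro Lim_bounded[OF tendsto_norm[OF lf[OF that]], of 0]) auto
  then show "g absolutely_integrable_on {0..a}"
    by (intro dominated_convergence_absolutely_integrable[OF ac_deriv_integrable[OF ac] h _ lf])
  fix x assume x: "0 \<le> x" "x \<le> a"
  have "(\<lambda>n. integral {0..x} (f n)) \<longlonglongrightarrow> integral {0..x} g"
  proof (rule dominated_convergence(2))
    show "f n integrable_on {0..x}" for n by (rule ac_deriv_HK_integrable[OF ac_deriv_subinterval[OF ac x(2)]])
    show "h integrable_on {0..x}" using x by (intro integrable_on_subinterval[OF h]) auto
  qed (use x le lf in auto)
  moreover have "(\<lambda>n. integral {0..x} (f n)) = (\<lambda>n. F n x - F n 0)"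
    using ac_deriv_diff[OF ac, of 0 x] x by auto
  moreover have "(\<lambda>n. F n x - F n 0) \<longlonglongrightarrow> G x - G 0" using x by (intro tendsto_diff lF) auto
  ultimately show "G x - G 0 = integral {0..x} g" by (metis LIMSEQ_unique)
qed

lemma ac_deriv_sum:
  assumes "\<And>k. ac_deriv a (F k) (f k)"
  shows "ac_deriv a (\<lambda>x. \<Sum>k<n. F k x) (\<lambda>x. \<Sum>k<(n::nat). f k x)"
proof (induction n)
  case 0 then show ?case using ac_deriv_const[of a 0] by simp
next
  case (Suc n) then show ?case using ac_deriv_add[OF Suc assms[of n]] by simp
qed

definition SL_series where "SL_series q A B \<mu> x = (\<Sum>n. picard q A B \<mu> n x)"
definition SL_dseries where "SL_dseries q A B \<mu> x = (\<Sum>n. dpicard q A B \<mu> n x)"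

lemma SL_series_sol:
  assumes q: "q absolutely_integrable_on {0..a}" and a: "a > 0"
  shows "SL_sol a q \<mu> (SL_series q A B \<mu>) (SL_dseries q A B \<mu>)"
    "SL_series q A B \<mu> 0 = A" "SL_dseries q A B \<mu> 0 = B"
proof -
  define b where "b = picard_majorant q A B a (norm \<mu>)"
  have bs: "summable b" unfolding b_def by (rule picard_majorant_summable)
  have p: "norm (picard q A B \<mu> n x) \<le> b n" and d: "norm (dpicard q A B \<mu> n x) \<le> b n" if "x \<in> {0..a}" for n x
    unfolding b_def by (rule picard_le_bd[OF q order_refl that a])+
  have b0: "b n \<ge> 0" for n using order_trans[OF norm_ge_zero p[of 0 n]] a by simp
  have lp: "(\<lambda>n. \<Sum>k<n. picard q A B \<mu> k x) \<longlonglongrightarrow> SL_series q A B \<mu> x" if "x \<in> {0..a}" for x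
    unfolding SL_series_def by (intro summable_LIMSEQ summable_comparison_test'[OF bs, of 0]) (use p that in auto)
  have ld: "(\<lambda>n. \<Sum>k<n. dpicard q A B \<mu> k x) \<longlonglongrightarrow> SL_dseries q A B \<mu> x" if "x \<in> {0..a}" for x
    unfolding SL_dseries_def by (intro summable_LIMSEQ summable_comparison_test'[OF bs, of 0]) (use d that in auto)
  have sb: "(\<Sum>k<n. b k) \<le> suminf b" for n by (intro sum_le_suminf bs) (auto simp: b0)
  have 1: "ac_deriv a (SL_series q A B \<mu>) (SL_dseries q A B \<mu>)"
  proof (rule ac_deriv_limit[OF ac_deriv_sum[OF picard_ac_deriv(1)[OF q]] _ _ ld lp])
    show "(\<lambda>x. suminf b) integrable_on {0..a}" by (intro integrable_continuous_real) auto
    fix n x assume "x \<in> {0..a}"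
    then have "norm (\<Sum>k<n. dpicard q A B \<mu> k x) \<le> (\<Sum>k<n. b k)" by (intro sum_norm_le d)
    then show "norm (\<Sum>k<n. dpicard q A B \<mu> k x) \<le> suminf b" using sb[of n] by linarith
  qed
  have ac2: "ac_deriv a (\<lambda>x. B + (\<Sum>k<n. dpicard q A B \<mu> (Suc k) x)) (\<lambda>x. (q x - \<mu>) * (\<Sum>k<n. picard q A B \<mu> k x))" for n
    by (rule ac_deriv_cong[OF ac_deriv_add[OF ac_deriv_const ac_deriv_sum[OF picard_ac_deriv(2)[OF q]]]])
       (auto simp: sum_distrib_left)
  have eq: "B + (\<Sum>k<n. dpicard q A B \<mu> (Suc k) x) = (\<Sum>k<Suc n. dpicard q A B \<mu> k x)" for n x
    unfolding sum.lessThan_Suc_shift by (simp add: dpicard_def)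
  have 2: "ac_deriv a (SL_dseries q A B \<mu>) (\<lambda>t. (q t - \<mu>) * SL_series q A B \<mu> t)"
  proof (rule ac_deriv_limit[OF ac2])
    have "(\<lambda>t. norm (q t - \<mu>)) integrable_on {0..a}"
      using abs_integrable_minus_const[OF q, of \<mu>] by (simp add: absolutely_integrable_on_def)
    then show "(\<lambda>x. norm (q x - \<mu>) * suminf b) integrable_on {0..a}" by (rule integrable_on_mult_left)
    fix x assume x: "x \<in> {0..a}"
    show "(\<lambda>n. (q x - \<mu>) * (\<Sum>k<n. picard q A B \<mu> k x)) \<longlonglongrightarrow> (q x - \<mu>) * SL_series q A B \<mu> x"
      by (intro tendsto_mult_left lp x)
    show "(\<lambda>n. B + (\<Sum>k<n. dpicard q A B \<mu> (Suc k) x)) \<longlonglongrightarrow> SL_dseries q A B \<mu> x"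
      unfolding eq using ld[OF x] by (rule LIMSEQ_Suc)
    fix n
    have "norm (\<Sum>k<n. picard q A B \<mu> k x) \<le> (\<Sum>k<n. b k)" using x by (intro sum_norm_le p)
    then have "norm (\<Sum>k<n. picard q A B \<mu> k x) \<le> suminf b" using sb[of n] by linarith
    then show "norm ((q x - \<mu>) * (\<Sum>k<n. picard q A B \<mu> k x)) \<le> norm (q x - \<mu>) * suminf b"
      unfolding norm_mult by (intro mult_left_mono) auto
  qed
  show "SL_sol a q \<mu> (SL_series q A B \<mu>) (SL_dseries q A B \<mu>)"
    using 1 2 by (simp add: SL_sol_def)
  have "picard q A B \<mu> n 0 = (if n = 0 then A else 0)" for n by (cases n) auto
  then show "SL_series q A B \<mu> 0 = A" unfolding SL_series_def by (subst suminf_finite[of "{0}"]) auto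
  have "dpicard q A B \<mu> n 0 = (if n = 0 then B else 0)" for n by (cases n) (auto simp: dpicard_def)
  then show "SL_dseries q A B \<mu> 0 = B" unfolding SL_dseries_def by (subst suminf_finite[of "{0}"]) auto
qed

text \<open>
  Polynomials in \<open>\<mu>\<close> with coefficients continuous in \<open>x\<close>, generated by Horner's scheme.  The Picard terms are of this
  form, because integration in \<open>x\<close> acts on the coefficients alone; hence they are holomorphic in \<open>\<mu>\<close>.
\<close>

inductive poly_family :: "real \<Rightarrow> (complex \<Rightarrow> real \<Rightarrow> complex) \<Rightarrow> bool" for a where
  const: "continuous_on {0..a} g \<Longrightarrow> poly_family a (\<lambda>\<mu>. g)"
| horner: "continuous_on {0..a} g \<Longrightarrow> poly_family a f \<Longrightarrow> poly_family a (\<lambda>\<mu> x. g x + \<mu> * f \<mu> x)"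
| cong: "poly_family a f \<Longrightarrow> (\<And>\<mu> x. x \<in> {0..a} \<Longrightarrow> f \<mu> x = g \<mu> x) \<Longrightarrow> poly_family a g"

lemma poly_family_continuous: "poly_family a f \<Longrightarrow> continuous_on {0..a} (f \<mu>)"
proof (induction rule: poly_family.induct)
  case (cong f g)
  then show ?case by (metis continuous_on_cong)
qed (auto intro!: continuous_intros)

lemma poly_family_holomorphic: "poly_family a f \<Longrightarrow> x \<in> {0..a} \<Longrightarrow> (\<lambda>\<mu>. f \<mu> x) holomorphic_on UNIV"
proof (induction rule: poly_family.induct)
  case (cong f g)
  then show ?case by simp
qed (auto intro!: holomorphic_intros)

lemma poly_family_add:
  assumes "poly_family a f" "poly_family a h"
  shows "poly_family a (\<lambda>\<mu> x. f \<mu> x + h \<mu> x)"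
  using assms
proof (induction arbitrary: h rule: poly_family.induct)
  case (const g)
  from const(2,1) show ?case
  proof (induction rule: poly_family.induct)
    case (const k)
    then show ?case by (intro poly_family.const continuous_intros)
  next
    case (horner k f)
    then have "poly_family a (\<lambda>\<mu> x. (g x + k x) + \<mu> * f \<mu> x)" by (intro poly_family.horner continuous_intros)
    then show ?case by (rule poly_family.cong) simp
  next
    case (cong f k)
    then show ?case by (metis (no_types, lifting) poly_family.cong)
  qed
next
  case (horner g f)
  from horner(4,1,2) show ?case
  proof (induction rule: poly_family.induct)
    case (const k)
    then have "poly_family a (\<lambda>\<mu> x. (g x + k x) + \<mu> * f \<mu> x)" by (intro poly_family.horner continuous_intros)
    then show ?case by (rule poly_family.cong) simp
  next
    case (horner k f')
    then have "poly_family a (\<lambda>\<mu> x. (g x + k x) + \<mu> * (f \<mu> x + f' \<mu> x))"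
      by (intro poly_family.horner continuous_intros \<open>\<And>h. poly_family a h \<Longrightarrow> poly_family a (\<lambda>\<mu> x. f \<mu> x + h \<mu> x)\<close>)
    then show ?case by (rule poly_family.cong) (simp add: algebra_simps)
  next
    case (cong f' k)
    then show ?case by (metis (no_types, lifting) poly_family.cong)
  qed
next
  case (cong f g)
  then show ?case by (metis (no_types, lifting) poly_family.cong)
qed

lemma poly_family_integral:
  assumes "poly_family a f" and p: "p absolutely_integrable_on {0..a}"
  shows "poly_family a (\<lambda>\<mu> x. integral {0..x} (\<lambda>t. p t * f \<mu> t))"
  using assms(1)
proof (induction rule: poly_family.induct)
  case (const g)
  have "continuous_on {0..a} (\<lambda>x. integral {0..x} (\<lambda>t. p t * g t))"
    by (intro ac_deriv_continuous[OF ac_deriv_integral] abs_integrable_continuous_mult const p)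
  then show ?case by (rule poly_family.const)
next
  case (horner g f)
  have i1: "(\<lambda>t. p t * g t) absolutely_integrable_on {0..a}"
    and i2: "(\<lambda>t. p t * f \<mu> t) absolutely_integrable_on {0..a}" for \<mu>
    by (intro abs_integrable_continuous_mult horner p poly_family_continuous[OF horner(2)])+
  have "continuous_on {0..a} (\<lambda>x. integral {0..x} (\<lambda>t. p t * g t))"
    by (intro ac_deriv_continuous[OF ac_deriv_integral] i1)
  then have "poly_family a (\<lambda>\<mu> x. integral {0..x} (\<lambda>t. p t * g t) + \<mu> * integral {0..x} (\<lambda>t. p t * f \<mu> t))"
    by (rule poly_family.horner) (rule horner)
  then show ?case
  proof (rule poly_family.cong)
    fix \<mu> x assume x: "x \<in> {0..a}"
    have j1: "(\<lambda>t. p t * g t) integrable_on {0..x}" and j2: "(\<lambda>t. p t * f \<mu> t) integrable_on {0..x}"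
      using abs_integrable_subinterval[OF i1, of 0 x] abs_integrable_subinterval[OF i2, of 0 x \<mu>] x
      by (auto simp: absolutely_integrable_on_def)
    have "integral {0..x} (\<lambda>t. p t * (g t + \<mu> * f \<mu> t)) = integral {0..x} (\<lambda>t. p t * g t + \<mu> * (p t * f \<mu> t))"
      by (simp add: algebra_simps)
    also have "\<dots> = integral {0..x} (\<lambda>t. p t * g t) + integral {0..x} (\<lambda>t. \<mu> * (p t * f \<mu> t))"
      by (intro integral_add j1 integrable_on_mult_right j2)
    finally show "integral {0..x} (\<lambda>t. p t * g t) + \<mu> * integral {0..x} (\<lambda>t. p t * f \<mu> t) =
        integral {0..x} (\<lambda>t. p t * (g t + \<mu> * f \<mu> t))" by simp
  qed
next
  case (cong f g)
  from cong(3) show ?case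
    by (rule poly_family.cong) (use cong(2) in \<open>auto intro!: integral_cong\<close>)
qed

lemma poly_family_picard:
  assumes q: "q absolutely_integrable_on {0..a}"
  shows "poly_family a (\<lambda>\<mu>. picard q A B \<mu> n)" "poly_family a (\<lambda>\<mu>. dpicard q A B \<mu> n)"
proof -
  have one: "(\<lambda>t. 1::complex) absolutely_integrable_on {0..a}"
    by (intro absolutely_integrable_continuous_real) auto
  have *: "poly_family a (\<lambda>\<mu>. dpicard q A B \<mu> (Suc n))" if p: "poly_family a (\<lambda>\<mu>. picard q A B \<mu> n)" for n
  proof -
    have "poly_family a (\<lambda>\<mu> x. integral {0..x} (\<lambda>t. q t * picard q A B \<mu> n t) +
       (0 + \<mu> * integral {0..x} (\<lambda>t. (-1) * picard q A B \<mu> n t)))"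
      using poly_family_integral[OF p absolutely_integrable_continuous_real[of 0 a "\<lambda>_. -1"]]
      by (intro poly_family_add poly_family_integral[OF p q] poly_family.horner) auto
    then show ?thesis
    proof (rule poly_family.cong)
      fix \<mu> x assume x: "x \<in> {0..a}"
      have c: "continuous_on {0..a} (picard q A B \<mu> n)" by (rule poly_family_continuous[OF p])
      have "(\<lambda>t. q t * picard q A B \<mu> n t) absolutely_integrable_on {0..a}"
        by (intro abs_integrable_continuous_mult c q)
      then have j1: "(\<lambda>t. q t * picard q A B \<mu> n t) integrable_on {0..x}"
        using abs_integrable_subinterval[of a "\<lambda>t. q t * picard q A B \<mu> n t" 0 x] x by (auto simp: absolutely_integrable_on_def)
      have j2: "picard q A B \<mu> n integrable_on {0..x}"
        using x by (intro integrable_continuous_real continuous_on_subset[OF c]) auto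
      have "dpicard q A B \<mu> (Suc n) x = integral {0..x} (\<lambda>t. q t * picard q A B \<mu> n t - \<mu> * picard q A B \<mu> n t)"
        by (simp add: dpicard_def algebra_simps)
      also have "\<dots> = integral {0..x} (\<lambda>t. q t * picard q A B \<mu> n t) - integral {0..x} (\<lambda>t. \<mu> * picard q A B \<mu> n t)"
        by (intro integral_diff j1 integrable_on_mult_right j2)
      finally show "integral {0..x} (\<lambda>t. q t * picard q A B \<mu> n t) +
       (0 + \<mu> * integral {0..x} (\<lambda>t. (-1) * picard q A B \<mu> n t)) = dpicard q A B \<mu> (Suc n) x" by simp
    qed
  qed
  have 1: "poly_family a (\<lambda>\<mu>. picard q A B \<mu> n)" for n
  proof (induction n)
    case 0
    then show ?case by (auto intro!: poly_family.const continuous_intros)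
  next
    case (Suc n)
    have "poly_family a (\<lambda>\<mu> x. integral {0..x} (\<lambda>t. 1 * dpicard q A B \<mu> (Suc n) t))"
      by (rule poly_family_integral[OF *[OF Suc] one])
    then show ?case by (simp add: dpicard_def[abs_def])
  qed
  show "poly_family a (\<lambda>\<mu>. picard q A B \<mu> n)" by (rule 1)
  show "poly_family a (\<lambda>\<mu>. dpicard q A B \<mu> n)"
  proof (cases n)
    case 0
    then show ?thesis by (auto simp: dpicard_def[abs_def] intro!: poly_family.const)
  qed (use *[OF 1] in auto)
qed

lemma holomorphic_suminf_bounded:
  assumes hol: "\<And>n. f n holomorphic_on UNIV"
    and le: "\<And>R n z. norm z \<le> R \<Longrightarrow> norm (f n z) \<le> b R n" and sb: "\<And>R. summable (b R)"
  shows "(\<lambda>z. \<Sum>n. f n z) holomorphic_on UNIV"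
proof (rule holomorphic_uniform_sequence[where f = "\<lambda>n z. \<Sum>k<n. f k z"])
  show "(\<lambda>z. \<Sum>k<n. f k z) holomorphic_on UNIV" for n by (intro holomorphic_intros hol)
  fix z :: complex
  have "uniform_limit (cball z 1) (\<lambda>n z. \<Sum>k<n. f k z) (\<lambda>z. \<Sum>n. f n z) sequentially"
  proof (rule Weierstrass_m_test[OF _ sb[of "norm z + 1"]])
    fix n x assume "x \<in> cball z 1"
    then have "norm x \<le> norm z + 1" using norm_triangle_sub[of x z] by (simp add: dist_norm norm_minus_commute)
    then show "norm (f n x) \<le> b (norm z + 1) n" by (rule le)
  qed
  then show "\<exists>d>0. cball z d \<subseteq> UNIV \<and> uniform_limit (cball z d) (\<lambda>n z. \<Sum>k<n. f k z) (\<lambda>z. \<Sum>n. f n z) sequentially"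
    by (intro exI[of _ 1]) auto
qed auto

lemma SL_series_holomorphic:
  assumes q: "q absolutely_integrable_on {0..a}" and a: "a > 0" and x: "x \<in> {0..a}"
  shows "(\<lambda>\<mu>. SL_series q A B \<mu> x) holomorphic_on UNIV" "(\<lambda>\<mu>. SL_dseries q A B \<mu> x) holomorphic_on UNIV"
proof -
  show "(\<lambda>\<mu>. SL_series q A B \<mu> x) holomorphic_on UNIV"
    unfolding SL_series_def
    by (rule holomorphic_suminf_bounded[OF poly_family_holomorphic[OF poly_family_picard(1)[OF q] x] picard_le_bd(1)[OF q _ x a] picard_majorant_summable])
  show "(\<lambda>\<mu>. SL_dseries q A B \<mu> x) holomorphic_on UNIV"
    unfolding SL_dseries_def
    by (rule holomorphic_suminf_bounded[OF poly_family_holomorphic[OF poly_family_picard(2)[OF q] x] picard_le_bd(2)[OF q _ x a] picard_majorant_summable])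
qed

section \<open>Zeros of entire functions of exponential type\<close>

text \<open>
  Since \<open>Ln 0 = 0\<close>, this extends \<open>w Ln w\<close> continuously to \<open>w = 0\<close>.
\<close>

definition xLn :: "complex \<Rightarrow> complex" where "xLn w = w * Ln w"

lemma norm_xLn_le:
  assumes "norm w \<le> 1"
  shows "norm (xLn w) \<le> 2 * sqrt (norm w) + pi * norm w"
proof (cases "w = 0")
  case False
  define x where "x = norm w"
  have x: "0 < x" "x \<le> 1" using assms False by (auto simp: x_def)
  have "- ln x = 2 * ln (1 / sqrt x)" using x by (simp add: ln_div ln_sqrt)
  also have "\<dots> \<le> 2 * (1 / sqrt x)" using x ln_le_minus_one[of "1 / sqrt x"] by simp
  finally have "x * \<bar>ln x\<bar> \<le> x * (2 * (1 / sqrt x))" using x by (intro mult_left_mono) auto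
  also have "\<dots> = 2 * sqrt x" using x real_div_sqrt[of x] by (simp add: field_simps)
  finally have 1: "x * \<bar>ln x\<bar> \<le> 2 * sqrt x" .
  have "norm (Ln w) \<le> \<bar>Re (Ln w)\<bar> + \<bar>Im (Ln w)\<bar>" by (rule cmod_le)
  also have "\<bar>Re (Ln w)\<bar> = \<bar>ln x\<bar>" using False by (simp add: x_def)
  also have "\<bar>Im (Ln w)\<bar> \<le> pi" using False mpi_less_Im_Ln[of w] Im_Ln_le_pi[of w] by (simp add: abs_le_iff)
  finally have "norm (xLn w) \<le> x * (\<bar>ln x\<bar> + pi)"
    using x unfolding xLn_def norm_mult x_def by (intro mult_left_mono) auto
  then show ?thesis using 1 by (simp add: x_def algebra_simps)
qed (simp add: xLn_def)

lemma xLn_tendsto_0: "(xLn \<longlongrightarrow> 0) (at 0)"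
proof (rule Lim_null_comparison)
  have "\<forall>\<^sub>F w::complex in at 0. dist w 0 < 1"
    unfolding eventually_at by (intro exI[of _ 1]) auto
  then show "\<forall>\<^sub>F w in at 0. norm (xLn w) \<le> 2 * sqrt (norm w) + pi * norm w"
    by eventually_elim (auto intro: norm_xLn_le)
  have "((\<lambda>w::complex. 2 * sqrt (norm w) + pi * norm w) \<longlongrightarrow> 2 * sqrt (norm (0::complex)) + pi * norm (0::complex)) (at 0)"
    by (intro tendsto_intros)
  then show "((\<lambda>w::complex. 2 * sqrt (norm w) + pi * norm w) \<longlongrightarrow> 0) (at 0)" by simp
qed

lemma xLn_continuous: "continuous_on {w. Re w \<ge> 0} xLn"
  unfolding continuous_on_eq_continuous_within
proof
  fix w assume w: "w \<in> {w. Re w \<ge> 0}"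
  have "isCont xLn w"
  proof (cases "w = 0")
    case True
    then show ?thesis using xLn_tendsto_0 by (simp add: isCont_def xLn_def)
  next
    case False
    then have "w \<notin> \<real>\<^sub>\<le>\<^sub>0" using w by (auto simp: complex_nonpos_Reals_iff complex_eq_iff)
    then show ?thesis unfolding xLn_def[abs_def] by (intro continuous_intros) auto
  qed
  then show "continuous (at w within {w. Re w \<ge> 0}) xLn" by (rule continuous_at_imp_continuous_at_within)
qed

text \<open>
  On the unit circle \<open>(1/z - z) / (2 i)\<close> is \<open>- Im z\<close>, and the imaginary part of \<open>Ln ((1 + z) / (1 - z))\<close> is \<open>pi/2\<close> times the sign of
  \<open>Im z\<close>.  Their product yields a function holomorphic in the disc, continuous up to the boundary, with boundary real part
  \<open>|Im z|\<close>; the logarithms are split so that the singular factors at \<open>1\<close> and \<open>-1\<close> appear as \<open>w Ln w\<close>.  The value at \<open>0\<close> is the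
  mean of \<open>|sin|\<close> over the circle.
\<close>

definition poisson_abs_Im :: "complex \<Rightarrow> complex" where
  "poisson_abs_Im z = (if z = 0 then 2 / of_real pi else ((1 - z) * xLn (1 + z) - (1 + z) * xLn (1 - z)) / (of_real pi * z))"

lemma poisson_abs_Im_holomorphic: "poisson_abs_Im holomorphic_on ball 0 1"
proof (rule pole_theorem_open_0)
  define g where "g z = ((1 - z) * xLn (1 + z) - (1 + z) * xLn (1 - z)) / of_real pi" for z
  have nz: "1 + z \<notin> \<real>\<^sub>\<le>\<^sub>0 \<and> 1 - z \<notin> \<real>\<^sub>\<le>\<^sub>0" if "z \<in> ball 0 1" for z :: complex
    using that abs_Re_le_cmod[of z] by (auto simp: complex_nonpos_Reals_iff)
  show "g holomorphic_on ball 0 1"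
    unfolding g_def xLn_def using nz by (intro holomorphic_intros) auto
  have "(g has_field_derivative 2 / of_real pi) (at 0)"
    unfolding g_def xLn_def by (auto intro!: derivative_eq_intros)
  then show "poisson_abs_Im 0 = deriv g 0" by (simp add: DERIV_imp_deriv poisson_abs_Im_def)
  show "g z = (z - 0) * poisson_abs_Im z" if "z \<in> ball 0 1 - {0}" for z
    using that by (simp add: g_def poisson_abs_Im_def)
  show "g 0 = 0" by (simp add: g_def)
qed auto

lemma poisson_abs_Im_continuous: "continuous_on (cball 0 1) poisson_abs_Im"
proof -
  have "continuous_on (cball 0 1 - ball 0 (1/2)) poisson_abs_Im"
  proof (rule continuous_on_eq)
    have "Re (1 + z) \<ge> 0 \<and> Re (1 - z) \<ge> 0" if "norm z \<le> 1" for z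
      using abs_Re_le_cmod[of z] that by auto
    then show "continuous_on (cball 0 1 - ball 0 (1/2)) (\<lambda>z. ((1 - z) * xLn (1 + z) - (1 + z) * xLn (1 - z)) / (of_real pi * z))"
      by (intro continuous_intros continuous_on_compose2[OF xLn_continuous]) auto
  qed (auto simp: poisson_abs_Im_def)
  moreover have "continuous_on (cball 0 (1/2)) poisson_abs_Im"
    using poisson_abs_Im_holomorphic by (rule holomorphic_on_imp_continuous_on[THEN continuous_on_subset]) auto
  ultimately have "continuous_on ((cball 0 1 - ball 0 (1/2)) \<union> cball 0 (1/2)) poisson_abs_Im"
    by (intro continuous_on_closed_Un) auto
  then show ?thesis by (rule continuous_on_subset) auto
qed

lemma Re_poisson_abs_Im:
  assumes "norm z = 1"
  shows "Re (poisson_abs_Im z) = \<bar>Im z\<bar>"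
proof (cases "z = 1 \<or> z = -1")
  case True
  then show ?thesis by (auto simp: poisson_abs_Im_def xLn_def)
next
  case False
  define x y where "x = Re z" and "y = Im z"
  have xy: "x\<^sup>2 + y\<^sup>2 = 1" using assms by (simp add: x_def y_def cmod_power2[symmetric])
  have zz: "z * cnj z = 1" using assms by (simp add: complex_norm_square[symmetric])
  have "\<bar>x\<bar> \<noteq> 1"
  proof
    assume "\<bar>x\<bar> = 1"
    then have "x\<^sup>2 = 1" by (simp add: power2_eq_1_iff abs_if split: if_splits)
    then have "y = 0" using xy by simp
    with \<open>\<bar>x\<bar> = 1\<close> False show False by (auto simp: x_def y_def complex_eq_iff abs_if split: if_splits)
  qed
  moreover have "\<bar>x\<bar> \<le> 1" using abs_Re_le_cmod[of z] assms by (simp add: x_def)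
  ultimately have x: "\<bar>x\<bar> < 1" by simp
  have y0: "y \<noteq> 0" using xy x by (auto simp: power2_eq_1_iff)
  define p q where "p = Im (Ln (1 + z))" and "q = Im (Ln (1 - z))"
  have nz: "1 + z \<noteq> 0" "1 - z \<noteq> 0" using False by (auto simp: add_eq_0_iff)
  have bp: "\<bar>p\<bar> < pi/2" "\<bar>q\<bar> < pi/2"
    using x nz Re_Ln_pos_lt[of "1 + z"] Re_Ln_pos_lt[of "1 - z"] by (auto simp: x_def p_def q_def)
  have "Ln ((1 + z) / (1 - z)) = Ln (1 + z) - Ln (1 - z)"
  proof -
    have "exp (Ln (1 + z) - Ln (1 - z)) = (1 + z) / (1 - z)" using nz by (simp add: exp_diff)
    moreover have "Ln (exp (Ln (1 + z) - Ln (1 - z))) = Ln (1 + z) - Ln (1 - z)"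
      using bp by (intro Ln_exp) (auto simp: p_def q_def abs_less_iff)
    ultimately show ?thesis by simp
  qed
  then have pq: "p - q = Im (Ln ((1 + z) / (1 - z)))" by (simp add: p_def q_def)
  define t where "t = y / (1 - x)"
  have "(1 + z) / (1 - z) = \<i> * of_real t"
  proof -
    have "(\<i> * of_real t) * (1 - z) = 1 + z"
    proof (rule complex_eqI)
      show "Re (\<i> * of_real t * (1 - z)) = Re (1 + z)"
        using x xy by (simp add: t_def x_def[symmetric] y_def[symmetric] field_simps power2_eq_square)
      show "Im (\<i> * of_real t * (1 - z)) = Im (1 + z)"
        using x by (simp add: t_def x_def[symmetric] y_def[symmetric] field_simps)
    qed
    then show ?thesis using nz(2) by (simp only: nonzero_divide_eq_eq not_False_eq_True)
  qed
  moreover have "sgn t = sgn y" using x by (simp add: t_def sgn_divide)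
  moreover have "Im (Ln (\<i> * of_real t)) = sgn t * (pi / 2)"
  proof (cases "t > 0")
    case True
    then have "Ln (of_real t * \<i>) = of_real (ln t) + Ln \<i>"
      using Ln_times_of_real[of t "\<i>"] by (simp add: Ln_of_real)
    then show ?thesis using True by (simp add: mult.commute)
  next
    case False
    have "t \<noteq> 0" using y0 x by (simp add: t_def)
    then have t: "- t > 0" using False by simp
    then have "Ln (of_real (- t) * (- \<i>)) = of_real (ln (- t)) + Ln (- \<i>)"
      using Ln_times_of_real[of "- t" "- \<i>"] by (simp add: Ln_of_real del: of_real_minus)
    then show ?thesis using t by (simp add: mult.commute)
  qed
  ultimately have pq': "p - q = sgn y * (pi / 2)" using pq by simp
  have z0: "z \<noteq> 0" using assms by auto
  have "poisson_abs_Im z = (1 - z) * (1 + z) * (Ln (1 + z) - Ln (1 - z)) / (of_real pi * z)"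
    using z0 by (simp add: poisson_abs_Im_def xLn_def algebra_simps)
  also have "\<dots> = (cnj z * z) * (1 - z) * (1 + z) * (Ln (1 + z) - Ln (1 - z)) / (of_real pi * z)"
    using zz by (simp add: mult.commute)
  also have "\<dots> = (cnj z - (z * cnj z) * z) * (Ln (1 + z) - Ln (1 - z)) / of_real pi"
    using z0 by (simp add: field_simps)
  also have "\<dots> = (cnj z - z) * (Ln (1 + z) - Ln (1 - z)) / of_real pi" using zz by simp
  also have "cnj z - z = - 2 * \<i> * of_real y" by (simp add: complex_eq_iff y_def)
  finally have "poisson_abs_Im z = of_real (- 2 * y / pi) * (\<i> * (Ln (1 + z) - Ln (1 - z)))" by simp
  then have "Re (poisson_abs_Im z) = (- 2 * y / pi) * Re (\<i> * (Ln (1 + z) - Ln (1 - z)))"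
    by (simp only: times_complex.sel Re_complex_of_real Im_complex_of_real mult_zero_left diff_zero)
  also have "\<dots> = 2 * y / pi * (p - q)" by (simp add: p_def q_def algebra_simps)
  also have "\<dots> = \<bar>y\<bar>" unfolding pq' by (simp add: abs_sgn field_simps)
  finally show ?thesis by (simp add: y_def)
qed

lemma entire_factor_zeros:
  assumes "finite A" "f holomorphic_on UNIV" "\<And>a. a \<in> A \<Longrightarrow> f a = 0"
  shows "\<exists>g. g holomorphic_on UNIV \<and> (\<forall>z. f z = g z * (\<Prod>a\<in>A. z - a))"
  using assms(1,3)
proof (induction A)
  case empty
  then show ?case using assms(2) by auto
next
  case (insert b A)
  then obtain g where g: "g holomorphic_on UNIV" "\<And>z. f z = g z * (\<Prod>a\<in>A. z - a)" by auto
  have "g b = 0" using insert g(2)[of b] by auto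
  define k where "k z = (if z = b then deriv g b else (g z - g b) / (z - b))" for z
  have "k holomorphic_on UNIV" unfolding k_def using g(1) by (intro pole_lemma_open) auto
  moreover have "g z = k z * (z - b)" for z using \<open>g b = 0\<close> by (auto simp: k_def)
  then have "f z = k z * (\<Prod>a\<in>insert b A. z - a)" for z
    using g(2)[of z] insert by (simp add: mult.assoc)
  ultimately show ?case by blast
qed

text \<open>
  Replace each factor \<open>z - a\<close> of \<open>f\<close> by the reflected factor of the same modulus on \<open>|z| = R\<close>, and divide by the exponential of a
  function with real part \<open>s |Im z|\<close> there.  The result is at most \<open>C\<close> on the circle, hence at \<open>0\<close>.
\<close>

lemma entire_jensen_inequality:
  assumes f: "f holomorphic_on UNIV" and R: "R > 0" and s: "s \<ge> 0"
    and A: "finite A" "\<And>a. a \<in> A \<Longrightarrow> f a = 0" and f0: "f 0 \<noteq> 0"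
    and le: "\<And>z. norm z = R \<Longrightarrow> norm (f z) \<le> C * exp (s * \<bar>Im z\<bar>)"
  shows "norm (f 0) * (\<Prod>a\<in>A. R / norm a) \<le> C * exp (2 * s * R / pi)"
proof -
  obtain g where g: "g holomorphic_on UNIV" "\<And>z. f z = g z * (\<Prod>a\<in>A. z - a)"
    using entire_factor_zeros[OF A(1) f A(2)] by blast
  define F where "F z = g z * (\<Prod>a\<in>A. (of_real (R\<^sup>2) - cnj a * z) / of_real R) * exp (- (s * R) * poisson_abs_Im (z / of_real R))" for z
  have "norm (F 0) \<le> C"
  proof (rule maximum_modulus_frontier[of F "cball 0 R"])
    have "(\<lambda>z. poisson_abs_Im (z / of_real R)) holomorphic_on ball 0 R"
      by (rule holomorphic_on_compose_gen[of "\<lambda>z. z / of_real R" _ poisson_abs_Im "ball 0 1", unfolded o_def])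
         (use R in \<open>auto intro!: holomorphic_intros poisson_abs_Im_holomorphic simp: norm_divide\<close>)
    then show "F holomorphic_on interior (cball 0 R)"
      unfolding F_def using R by (auto intro!: holomorphic_intros holomorphic_on_subset[OF g(1)])
    have "continuous_on (cball 0 R) (\<lambda>z. poisson_abs_Im (z / of_real R))"
      by (rule continuous_on_compose2[OF poisson_abs_Im_continuous])
         (use R in \<open>auto intro!: continuous_intros simp: norm_divide\<close>)
    then show "continuous_on (closure (cball 0 R)) F"
      unfolding F_def using R
      by (auto intro!: continuous_intros continuous_on_subset[OF holomorphic_on_imp_continuous_on[OF g(1)]])
    fix z :: complex assume "z \<in> frontier (cball 0 R)"
    then have z: "norm z = R" using R by auto
    have "norm ((of_real (R\<^sup>2) - cnj a * z) / of_real R) = norm (z - a)" for a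
    proof -
      have "of_real (R\<^sup>2) = cnj z * z" using z by (metis complex_norm_square mult.commute)
      then have "of_real (R\<^sup>2) - cnj a * z = cnj (z - a) * z" by (simp add: algebra_simps)
      then have "norm (of_real (R\<^sup>2) - cnj a * z) = norm (z - a) * R" using z by (metis complex_mod_cnj norm_mult)
      then show ?thesis using R by (simp add: norm_divide del: of_real_power)
    qed
    then have "norm (F z) = norm (f z) * exp (Re (- (s * R) * poisson_abs_Im (z / of_real R)))"
      unfolding F_def g(2) by (simp add: norm_mult prod_norm[symmetric])
    also have "Re (- (s * R) * poisson_abs_Im (z / of_real R)) = - (s * \<bar>Im z\<bar>)"
      using Re_poisson_abs_Im[of "z / of_real R"] z R by (simp add: norm_divide)
    finally have "norm (F z) = norm (f z) * exp (- (s * \<bar>Im z\<bar>))" .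
    also have "\<dots> \<le> (C * exp (s * \<bar>Im z\<bar>)) * exp (- (s * \<bar>Im z\<bar>))" by (intro mult_right_mono le z) auto
    also have "\<dots> = C" by (simp add: exp_minus_inverse mult.assoc)
    finally show "norm (F z) \<le> C" .
  qed (use R in auto)
  moreover have "norm (F 0) = norm (f 0) * (\<Prod>a\<in>A. R / norm a) * exp (- (2 * s * R / pi))"
  proof -
    have a0: "a \<noteq> 0" if "a \<in> A" for a using A(2) f0 that by auto
    have "norm (f 0) * (\<Prod>a\<in>A. R / norm a) = norm (g 0) * ((\<Prod>a\<in>A. norm a) * (\<Prod>a\<in>A. R / norm a))"
      by (simp add: g(2) norm_mult prod_norm[symmetric])
    also have "(\<Prod>a\<in>A. norm a) * (\<Prod>a\<in>A. R / norm a) = (\<Prod>a\<in>A. R)"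
      unfolding prod.distrib[symmetric] using a0 by (intro prod.cong) auto
    finally have "norm (f 0) * (\<Prod>a\<in>A. R / norm a) = norm (g 0) * R ^ card A" by simp
    moreover have "norm (F 0) = norm (g 0) * R ^ card A * exp (- (2 * s * R / pi))"
      using R by (simp add: F_def norm_mult norm_power poisson_abs_Im_def power2_eq_square)
    ultimately show ?thesis by simp
  qed
  ultimately have "norm (f 0) * (\<Prod>a\<in>A. R / norm a) * exp (- (2 * s * R / pi)) \<le> C" by simp
  then show ?thesis by (simp add: exp_minus field_simps)
qed

text \<open>
  If \<open>k\<close> is the last index counted, then \<open>R / x\<close> is at least the \<open>k\<close>-th power of \<open>1/\<theta>\<close>, and at most \<open>k\<close> indices are counted.
\<close>

lemma ln_ratio_ge_count:
  fixes R \<theta> x :: real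
  assumes "0 < \<theta>" "\<theta> < 1" "0 < x" "x \<le> R"
  shows "ln (1/\<theta>) * (\<Sum>j=1..J. if x \<le> R * \<theta> ^ j then 1 else 0) \<le> ln (R / x)"
proof -
  define S where "S = {j\<in>{1..J}. x \<le> R * \<theta> ^ j}"
  have eq: "(\<Sum>j=1..J. if x \<le> R * \<theta> ^ j then 1 else 0) = real (card S)"
    unfolding S_def by (subst sum.inter_filter[symmetric]) auto
  show ?thesis
  proof (cases "S = {}")
    case True
    then show ?thesis unfolding eq using assms by simp
  next
    case False
    have fS: "finite S" by (simp add: S_def)
    define k where "k = Max S"
    have "k \<in> S" unfolding k_def using fS False by (rule Max_in)
    then have k: "x \<le> R * \<theta> ^ k" by (simp add: S_def)
    have "S \<subseteq> {1..k}" using fS by (auto simp: k_def S_def[symmetric]) (auto simp: S_def)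
    then have "card S \<le> k" using card_mono[of "{1..k}" S] by simp
    moreover have "ln (1/\<theta>) \<ge> 0" using assms by simp
    ultimately have "ln (1/\<theta>) * card S \<le> ln (1/\<theta>) * k" by (intro mult_left_mono) auto
    also have "\<dots> = ln ((1/\<theta>) ^ k)" using assms by (simp add: ln_realpow)
    also have "\<dots> \<le> ln (R / x)"
      using k assms by (intro ln_mono) (auto simp: field_simps power_divide)
    finally show ?thesis unfolding eq .
  qed
qed

text \<open>
  Recentring at a point of modulus \<open>|d|\<close> changes the radii by at most \<open>|d|\<close>, which costs an arbitrarily small part of the density.
\<close>

lemma zero_count_lower:
  assumes cnt: "(\<lambda>r. real (count_upto \<Omega> r)) \<sim>[at_top] (\<lambda>r. 2 * m * r / pi)" and m: "0 < m'" "m' < m"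
  obtains r0 where "\<And>r. r \<ge> r0 \<Longrightarrow> finite (\<Omega> \<inter> {l. norm l \<le> r + \<bar>d\<bar>})
      \<and> real (card (\<Omega> \<inter> {l. norm l \<le> r - \<bar>d\<bar>})) \<ge> 2 * m' * r / pi"
proof -
  define m1 where "m1 = (m + m') / 2"
  have m1: "0 < m1" "m' < m1" "m1 < m" using m by (auto simp: m1_def)
  have "((\<lambda>r. real (count_upto \<Omega> r) / (2 * m * r / pi)) \<longlongrightarrow> 1) at_top"
    using cnt by (rule asymp_equivD_strong) (use m in \<open>auto intro!: eventually_mono[OF eventually_gt_at_top[of 0]]\<close>)
  then have "\<forall>\<^sub>F r in at_top. real (count_upto \<Omega> r) / (2 * m * r / pi) > m1 / m"
    by (rule order_tendstoD) (use m m1 in auto)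
  then have "\<forall>\<^sub>F r in at_top. real (count_upto \<Omega> r) > 2 * m1 * r / pi"
    using eventually_gt_at_top[of 0]
    by eventually_elim (use m in \<open>auto simp: field_simps\<close>)
  then obtain r1 where r1: "\<And>r. r \<ge> r1 \<Longrightarrow> real (count_upto \<Omega> r) > 2 * m1 * r / pi"
    unfolding eventually_at_top_linorder by blast
  define r0 where "r0 = max (max (r1 + \<bar>d\<bar>) (m1 * \<bar>d\<bar> / (m1 - m'))) 0"
  show ?thesis
  proof (rule that[of r0])
    fix r assume r: "r \<ge> r0"
    have r': "r \<ge> 0" "r - \<bar>d\<bar> \<ge> r1" "r \<ge> m1 * \<bar>d\<bar> / (m1 - m')" using r by (auto simp: r0_def)
    have "0 \<le> 2 * m1 * (r + \<bar>d\<bar>) / pi" using r' m1 by simp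
    also have "\<dots> < real (count_upto \<Omega> (r + \<bar>d\<bar>))" using r' by (intro r1) auto
    finally have "finite (\<Omega> \<inter> {l. norm l \<le> r + \<bar>d\<bar>})" by (simp add: count_upto_def card_gt_0_iff)
    moreover have "m1 * \<bar>d\<bar> \<le> r * (m1 - m')" using r' m1 by (simp add: divide_le_eq)
    then have "2 * m' * r / pi \<le> 2 * m1 * (r - \<bar>d\<bar>) / pi" by (intro divide_right_mono) (auto simp: algebra_simps)
    then have "2 * m' * r / pi \<le> real (card (\<Omega> \<inter> {l. norm l \<le> r - \<bar>d\<bar>}))"
      using r1[OF r'(2)] by (simp add: count_upto_def)
    ultimately show "finite (\<Omega> \<inter> {l. norm l \<le> r + \<bar>d\<bar>})
      \<and> real (card (\<Omega> \<inter> {l. norm l \<le> r - \<bar>d\<bar>})) \<ge> 2 * m' * r / pi" by blast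
  qed
qed

text \<open>
  A Riemann sum over the geometric radii \<open>R \<theta>\<^sup>j\<close> for the integral of \<open>n(t)/t\<close> that appears in Jensen's formula.
\<close>

lemma sum_ln_ratio_lower:
  fixes A :: "complex set"
  assumes A: "finite A" "\<And>a. a \<in> A \<Longrightarrow> a \<noteq> 0 \<and> norm a \<le> R" and \<theta>: "0 < \<theta>" "\<theta> < 1" and m: "0 < m" and R: "R > 0"
    and cnt: "\<And>j. j \<in> {1..J} \<Longrightarrow> real (card {a\<in>A. norm a \<le> R * \<theta> ^ j}) \<ge> 2 * m * (R * \<theta> ^ j) / pi"
  shows "(\<Sum>a\<in>A. ln (R / norm a)) \<ge> 2 * m * R / pi * (\<theta> - \<theta> ^ Suc J)"
proof -
  have geo: "(\<Sum>j=1..J. \<theta> ^ j) * (1 - \<theta>) = \<theta> - \<theta> ^ Suc J"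
  proof (induction J)
    case (Suc J)
    have "(\<Sum>j=1..Suc J. \<theta> ^ j) * (1 - \<theta>) = (\<Sum>j=1..J. \<theta> ^ j) * (1 - \<theta>) + \<theta> ^ Suc J * (1 - \<theta>)"
      by (simp add: distrib_right)
    also have "\<dots> = (\<theta> - \<theta> ^ Suc J) + \<theta> ^ Suc J * (1 - \<theta>)" by (simp only: Suc)
    also have "\<dots> = \<theta> - \<theta> ^ Suc (Suc J)" by (simp add: algebra_simps)
    finally show ?case .
  qed simp
  have "2 * m * R / pi * (\<theta> - \<theta> ^ Suc J) = (1 - \<theta>) * (\<Sum>j=1..J. 2 * m * (R * \<theta> ^ j) / pi)"
    unfolding geo[symmetric] by (simp add: sum_distrib_left sum_distrib_right mult_ac)
  also have "\<dots> \<le> ln (1/\<theta>) * (\<Sum>j=1..J. real (card {a\<in>A. norm a \<le> R * \<theta> ^ j}))"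
  proof (intro mult_mono sum_mono cnt sum_nonneg)
    show "1 - \<theta> \<le> ln (1/\<theta>)" using ln_le_minus_one[of \<theta>] \<theta> by (simp add: ln_div)
  qed (use \<theta> m R in auto)
  also have "\<dots> = ln (1/\<theta>) * (\<Sum>j=1..J. \<Sum>a\<in>A. if norm a \<le> R * \<theta> ^ j then 1 else 0)"
    by (intro arg_cong[where f = "\<lambda>x. ln (1/\<theta>) * x"] sum.cong refl) (use A in \<open>simp add: sum.If_cases Int_def\<close>)
  also have "\<dots> = (\<Sum>a\<in>A. ln (1/\<theta>) * (\<Sum>j=1..J. if norm a \<le> R * \<theta> ^ j then 1 else 0))"
    by (subst sum.swap) (simp add: sum_distrib_left)
  also have "\<dots> \<le> (\<Sum>a\<in>A. ln (R / norm a))"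
    using A \<theta> by (intro sum_mono ln_ratio_ge_count) auto
  finally show ?thesis .
qed

text \<open>
  Jensen's inequality is applied around a point \<open>z0\<close> where \<open>f\<close> does not vanish.  Up to a linear factor, its right-hand side grows
  like \<open>exp (2 s R / pi)\<close>, while the product over the zeros grows at least like \<open>exp (2 s1 R / pi)\<close> with \<open>s1 > s\<close>.
\<close>

lemma entire_zero_count_imp_zero:
  assumes f: "f holomorphic_on UNIV" and s: "s > 0" "m > s"
    and le: "\<And>z. norm (f z) \<le> K * (1 + norm z) * exp (s * \<bar>Im z\<bar>)"
    and z: "\<And>z. z \<in> \<Omega> \<Longrightarrow> f z = 0"
    and cnt: "(\<lambda>r. real (count_upto \<Omega> r)) \<sim>[at_top] (\<lambda>r. 2 * m * r / pi)"
  shows "f z0 = 0"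
proof (rule ccontr)
  assume nz: "f z0 \<noteq> 0"
  define f1 where "f1 z = f (z0 + z)" for z
  define m1 where "m1 = (s + m) / 2"
  have m1: "0 < m1" "s < m1" "m1 < m" using s by (auto simp: m1_def)
  obtain r0 where r0: "\<And>r. r \<ge> r0 \<Longrightarrow> finite (\<Omega> \<inter> {l. norm l \<le> r + \<bar>norm z0\<bar>})"
    "\<And>r. r \<ge> r0 \<Longrightarrow> real (card (\<Omega> \<inter> {l. norm l \<le> r - \<bar>norm z0\<bar>})) \<ge> 2 * m1 * r / pi"
    using zero_count_lower[OF cnt m1(1,3), of "norm z0"] by metis
  \<comment> \<open>The radii \<open>R \<theta>\<^sup>j\<close> with \<open>1 \<le> j \<le> J\<close> recover the density \<open>m1\<close> up to the factor \<open>\<theta> - \<theta> ^ Suc J\<close>;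
    with \<open>\<theta>\<close> close to \<open>1\<close> and \<open>J\<close> large the result \<open>s1\<close> stays above \<open>s\<close>.\<close>
  define \<theta> where "\<theta> = (s / m1 + 1) / 2"
  have \<theta>: "0 < \<theta>" "\<theta> < 1" "m1 * \<theta> > s" using s m1 by (auto simp: \<theta>_def field_simps)
  obtain J where J: "\<theta> ^ J < (m1 * \<theta> - s) / m1"
    using real_arch_pow_inv[of "(m1 * \<theta> - s) / m1" \<theta>] \<theta> m1 by auto
  define s1 where "s1 = m1 * (\<theta> - \<theta> ^ Suc J)"
  have s1: "s < s1"
  proof -
    have "\<theta> ^ Suc J \<le> \<theta> ^ J" using \<theta> by (intro power_decreasing) auto
    then have "m1 * \<theta> ^ Suc J \<le> m1 * \<theta> ^ J" using m1 by (intro mult_left_mono) auto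
    also have "\<dots> < m1 * \<theta> - s" using J m1 by (simp add: less_divide_eq mult.commute)
    finally have "m1 * \<theta> ^ Suc J < m1 * \<theta> - s" .
    then show ?thesis by (simp add: s1_def algebra_simps)
  qed
  have K: "K \<ge> 0" using le[of 0] by (simp add: order_trans[OF norm_ge_zero])
  define K1 where "K1 = K * (1 + norm z0) * exp (s * norm z0)"
  have K1: "K1 \<ge> 0" using K by (simp add: K1_def)
  have le1: "norm (f1 z) \<le> K1 * (1 + norm z) * exp (s * \<bar>Im z\<bar>)" for z
  proof -
    have "norm (f1 z) \<le> K * (1 + norm (z0 + z)) * exp (s * \<bar>Im (z0 + z)\<bar>)" unfolding f1_def by (rule le)
    also have "\<dots> \<le> K * ((1 + norm z0) * (1 + norm z)) * exp (s * (norm z0 + \<bar>Im z\<bar>))"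
    proof (intro mult_mono)
      have "0 \<le> norm z0 * norm z" by simp
      then have "1 + norm (z0 + z) \<le> 1 + norm z0 + norm z + norm z0 * norm z" using norm_triangle_ineq[of z0 z] by linarith
      then show "1 + norm (z0 + z) \<le> (1 + norm z0) * (1 + norm z)" by (simp add: algebra_simps)
      have "\<bar>Im (z0 + z)\<bar> \<le> norm z0 + \<bar>Im z\<bar>" using abs_Im_le_cmod[of z0] by simp
      then show "exp (s * \<bar>Im (z0 + z)\<bar>) \<le> exp (s * (norm z0 + \<bar>Im z\<bar>))" using s by simp
    qed (use K in auto)
    also have "\<dots> = K1 * (1 + norm z) * exp (s * \<bar>Im z\<bar>)" by (simp add: K1_def distrib_left[of s] exp_add mult_ac)
    finally show ?thesis .
  qed
  have hol: "f1 holomorphic_on UNIV"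
    unfolding f1_def by (rule holomorphic_on_compose_gen[OF _ f, unfolded o_def]) (auto intro!: holomorphic_intros)
  define c where "c = 2 * (s1 - s) / pi"
  have c: "c > 0" using s1 by (simp add: c_def)
  define F0 where "F0 = norm (f z0)"
  have F0: "F0 > 0" using nz by (simp add: F0_def)
  have key: "F0 * exp (c * R) \<le> K1 * (1 + R)" if R: "R \<ge> max 1 (r0 / \<theta> ^ J)" "R \<ge> r0" for R
  proof -
    have Rp: "R > 0" using R by simp
    define A where "A = {a. z0 + a \<in> \<Omega> \<and> norm a \<le> R}"
    have "(+) z0 ` A \<subseteq> \<Omega> \<inter> {l. norm l \<le> R + \<bar>norm z0\<bar>}"
      using norm_triangle_ineq by (fastforce simp: A_def intro: order_trans[OF norm_triangle_ineq])
    then have "finite ((+) z0 ` A)" using r0(1)[OF R(2)] by (rule finite_subset)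
    then have finA: "finite A" by (rule finite_imageD) auto
    have A0: "f1 a = 0" if "a \<in> A" for a using that z by (simp add: A_def f1_def)
    have f10: "f1 0 \<noteq> 0" using nz by (simp add: f1_def)
    have "norm (f1 0) * (\<Prod>a\<in>A. R / norm a) \<le> (K1 * (1 + R)) * exp (2 * s * R / pi)"
      by (rule entire_jensen_inequality[OF hol Rp _ finA A0 f10]) (use s le1 in \<open>force+\<close>)
    moreover have "(\<Prod>a\<in>A. R / norm a) \<ge> exp (2 * s1 * R / pi)"
    proof -
      have "2 * m1 * R / pi * (\<theta> - \<theta> ^ Suc J) \<le> (\<Sum>a\<in>A. ln (R / norm a))"
      proof (rule sum_ln_ratio_lower[OF finA _ \<theta>(1,2) m1(1) Rp])
        show "a \<noteq> 0 \<and> norm a \<le> R" if "a \<in> A" for a using that A0 f10 by (auto simp: A_def)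
        fix j assume j: "j \<in> {1..J}"
        define r where "r = R * \<theta> ^ j"
        have "\<theta> ^ J \<le> \<theta> ^ j" using \<theta> j by (intro power_decreasing) auto
        moreover have "r0 \<le> R * \<theta> ^ J" using R \<theta> by (simp add: divide_le_eq)
        ultimately have rr: "r \<ge> r0" using Rp unfolding r_def by (meson mult_left_mono less_imp_le order_trans)
        have rR: "r \<le> R" using Rp \<theta> by (simp add: r_def mult_left_le power_le_one)
        have "\<Omega> \<inter> {l. norm l \<le> r - \<bar>norm z0\<bar>} \<subseteq> (+) z0 ` {a\<in>A. norm a \<le> r}"
        proof
          fix l assume l: "l \<in> \<Omega> \<inter> {l. norm l \<le> r - \<bar>norm z0\<bar>}"
          then have "norm (l - z0) \<le> r" using norm_triangle_ineq4[of l z0] by auto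
          then have "l - z0 \<in> {a\<in>A. norm a \<le> r}" using l rR by (auto simp: A_def)
          then show "l \<in> (+) z0 ` {a\<in>A. norm a \<le> r}" by (intro image_eqI[of _ _ "l - z0"]) auto
        qed
        then have "card (\<Omega> \<inter> {l. norm l \<le> r - \<bar>norm z0\<bar>}) \<le> card ((+) z0 ` {a\<in>A. norm a \<le> r})"
          using finA by (intro card_mono) auto
        also have "\<dots> \<le> card {a\<in>A. norm a \<le> r}" using finA by (intro card_image_le) auto
        finally show "2 * m1 * (R * \<theta> ^ j) / pi \<le> real (card {a\<in>A. norm a \<le> R * \<theta> ^ j})"
          using r0(2)[OF rr] by (simp add: r_def)
      qed
      then have "exp (2 * s1 * R / pi) \<le> exp (\<Sum>a\<in>A. ln (R / norm a))" by (simp add: s1_def mult_ac)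
      also have "\<dots> = (\<Prod>a\<in>A. R / norm a)"
      proof -
        have "a \<noteq> 0" if "a \<in> A" for a using A0[OF that] f10 by auto
        then show ?thesis unfolding exp_sum[OF finA] using Rp by (intro prod.cong refl exp_ln) auto
      qed
      finally show ?thesis .
    qed
    ultimately have "F0 * exp (2 * s1 * R / pi) \<le> (K1 * (1 + R)) * exp (2 * s * R / pi)"
      using F0 by (simp add: F0_def f1_def) (meson mult_left_mono norm_ge_zero order_trans)
    moreover have "exp (2 * s1 * R / pi) = exp (c * R) * exp (2 * s * R / pi)"
      by (simp add: c_def exp_add[symmetric] field_simps)
    ultimately show ?thesis by simp
  qed
  \<comment> \<open>From this radius on, the quadratic Taylor term of \<open>exp (c * R)\<close> violates \<open>key\<close>.\<close>
  define R where "R = max (max (max 1 (r0 / \<theta> ^ J)) r0) (4 * K1 / (F0 * c\<^sup>2) + 1)"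
  have R: "R \<ge> max 1 (r0 / \<theta> ^ J)" "R \<ge> r0" "R \<ge> 1" "R > 4 * K1 / (F0 * c\<^sup>2)" by (auto simp: R_def)
  have "c * R > 0" using c R(3) by simp
  then have "F0 * ((c * R)\<^sup>2 / 2) < F0 * exp (c * R)"
    using exp_lower_Taylor_quadratic[of "c * R"] F0 by (intro mult_strict_left_mono) linarith+
  also have "\<dots> \<le> K1 * (1 + R)" by (rule key[OF R(1,2)])
  also have "\<dots> \<le> K1 * (2 * R)" using R K1 by (intro mult_left_mono) auto
  finally have "R * (F0 * c\<^sup>2 * R) < R * (4 * K1)" by (simp add: power2_eq_square algebra_simps)
  then have "F0 * c\<^sup>2 * R < 4 * K1" using R by simp
  moreover have "4 * K1 < F0 * c\<^sup>2 * R" using R(4) F0 c by (simp add: divide_less_eq mult_ac)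
  ultimately show False by simp
qed

section \<open>Growth of the normalised solutions\<close>

text \<open>
  Solutions normalised at \<open>b\<close> are combinations of those normalised at \<open>0\<close>, with entire coefficients given by the values of the
  latter at \<open>b\<close>.
\<close>

lemma fundamental_system_at:
  assumes q: "q absolutely_integrable_on {0..a}" and a: "a > 0" and b: "b \<in> {0..a}"
  obtains C dC S dS where
    "\<And>\<mu>. SL_sol a q \<mu> (C \<mu>) (dC \<mu>)" "\<And>\<mu>. SL_sol a q \<mu> (S \<mu>) (dS \<mu>)"
    "\<And>\<mu>. C \<mu> b = 1" "\<And>\<mu>. dC \<mu> b = 0" "\<And>\<mu>. S \<mu> b = 0" "\<And>\<mu>. dS \<mu> b = 1"
    "\<And>x. x \<in> {0..a} \<Longrightarrow> (\<lambda>\<mu>. C \<mu> x) holomorphic_on UNIV" "\<And>x. x \<in> {0..a} \<Longrightarrow> (\<lambda>\<mu>. S \<mu> x) holomorphic_on UNIV"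
proof -
  define c0 s0 dc0 ds0 where "c0 = SL_series q 1 0" and "s0 = SL_series q 0 1"
    and "dc0 = SL_dseries q 1 0" and "ds0 = SL_dseries q 0 1"
  have c: "SL_sol a q \<mu> (c0 \<mu>) (dc0 \<mu>)" "c0 \<mu> 0 = 1" "dc0 \<mu> 0 = 0" for \<mu>
    unfolding c0_def dc0_def by (rule SL_series_sol[OF q a])+
  have s: "SL_sol a q \<mu> (s0 \<mu>) (ds0 \<mu>)" "s0 \<mu> 0 = 0" "ds0 \<mu> 0 = 1" for \<mu>
    unfolding s0_def ds0_def by (rule SL_series_sol[OF q a])+
  have h: "(\<lambda>\<mu>. c0 \<mu> x) holomorphic_on UNIV" "(\<lambda>\<mu>. dc0 \<mu> x) holomorphic_on UNIV"
    "(\<lambda>\<mu>. s0 \<mu> x) holomorphic_on UNIV" "(\<lambda>\<mu>. ds0 \<mu> x) holomorphic_on UNIV" if "x \<in> {0..a}" for x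
    unfolding c0_def dc0_def s0_def ds0_def by (rule SL_series_holomorphic[OF q a that])+
  have W: "c0 \<mu> b * ds0 \<mu> b - dc0 \<mu> b * s0 \<mu> b = 1" for \<mu>
    using wronskian_const[OF c(1) s(1) b, of 0] a by (simp add: c s)
  show ?thesis
  proof (rule that[of "\<lambda>\<mu> x. ds0 \<mu> b * c0 \<mu> x + (- dc0 \<mu> b) * s0 \<mu> x" "\<lambda>\<mu> x. ds0 \<mu> b * dc0 \<mu> x + (- dc0 \<mu> b) * ds0 \<mu> x"
        "\<lambda>\<mu> x. (- s0 \<mu> b) * c0 \<mu> x + c0 \<mu> b * s0 \<mu> x" "\<lambda>\<mu> x. (- s0 \<mu> b) * dc0 \<mu> x + c0 \<mu> b * ds0 \<mu> x"])
    fix \<mu>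
    show "SL_sol a q \<mu> (\<lambda>x. ds0 \<mu> b * c0 \<mu> x + (- dc0 \<mu> b) * s0 \<mu> x) (\<lambda>x. ds0 \<mu> b * dc0 \<mu> x + (- dc0 \<mu> b) * ds0 \<mu> x)"
      "SL_sol a q \<mu> (\<lambda>x. (- s0 \<mu> b) * c0 \<mu> x + c0 \<mu> b * s0 \<mu> x) (\<lambda>x. (- s0 \<mu> b) * dc0 \<mu> x + c0 \<mu> b * ds0 \<mu> x)"
      by (intro SL_sol_lincomb c s)+
    show "ds0 \<mu> b * c0 \<mu> b + (- dc0 \<mu> b) * s0 \<mu> b = 1" "(- s0 \<mu> b) * dc0 \<mu> b + c0 \<mu> b * ds0 \<mu> b = 1"
      using W[of \<mu>] by (simp_all add: mult.commute)
  qed (use h b in \<open>auto intro!: holomorphic_intros\<close>)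
qed

definition SL_family :: "real \<Rightarrow> (real \<Rightarrow> complex) \<Rightarrow> real \<Rightarrow> complex \<Rightarrow> (complex \<Rightarrow> real \<Rightarrow> complex) \<Rightarrow> (complex \<Rightarrow> real \<Rightarrow> complex) \<Rightarrow> bool" where
  "SL_family a q \<alpha> \<beta> y dy \<longleftrightarrow> (\<forall>l. SL_sol a q (l\<^sup>2) (y l) (dy l) \<and> y l 0 = 1 \<and> dy l 0 = \<i> * of_real \<alpha> * l + \<beta>)"

lemma SL_family_holomorphic:
  assumes fam: "SL_family a q \<alpha> \<beta> y dy" and q: "q absolutely_integrable_on {0..a}" and a: "a > 0" and x: "x \<in> {0..a}"
  shows "(\<lambda>l. y l x) holomorphic_on UNIV" "(\<lambda>l. dy l x) holomorphic_on UNIV"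
proof -
  have y: "SL_sol a q (l\<^sup>2) (y l) (dy l)" "y l 0 = 1" "dy l 0 = \<i> * of_real \<alpha> * l + \<beta>" for l
    using fam by (auto simp: SL_family_def)
  have sq: "(\<lambda>l. f (l\<^sup>2)) holomorphic_on UNIV" if "f holomorphic_on UNIV" for f :: "complex \<Rightarrow> complex"
    by (rule holomorphic_on_compose_gen[of "\<lambda>l. l\<^sup>2", OF _ that, unfolded o_def]) (auto intro!: holomorphic_intros)
  note h = SL_series_holomorphic[OF q a x, THEN sq]
  have "y l x = 1 * SL_series q 1 0 (l\<^sup>2) x + (\<i> * of_real \<alpha> * l + \<beta>) * SL_series q 0 1 (l\<^sup>2) x"
       "dy l x = 1 * SL_dseries q 1 0 (l\<^sup>2) x + (\<i> * of_real \<alpha> * l + \<beta>) * SL_dseries q 0 1 (l\<^sup>2) x" for l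
    using SL_sol_expand[OF y(1) SL_series_sol(1)[OF q a, of "l\<^sup>2" 1 0] SL_series_sol(1)[OF q a, of "l\<^sup>2" 0 1], of 0 x]
      a x y[of l] SL_series_sol(2,3)[OF q a] by auto
  then show "(\<lambda>l. y l x) holomorphic_on UNIV" "(\<lambda>l. dy l x) holomorphic_on UNIV"
    by (simp_all only:) (intro holomorphic_intros h)+
qed

lemma SL_family_bound:
  assumes fam: "SL_family b q \<alpha> \<beta> y dy" and q: "q absolutely_integrable_on {0..b}"
    and l: "norm l \<ge> 1" "norm l \<ge> 2 * integral {0..b} (\<lambda>t. norm (q t))" and x: "x \<in> {0..b}"
  shows "norm (y l x) \<le> 2 * (1 + \<bar>\<alpha>\<bar> + norm \<beta>) * exp (\<bar>Im l\<bar> * x)"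
proof -
  have y: "SL_sol b q (l\<^sup>2) (y l) (dy l)" "y l 0 = 1" "dy l 0 = \<i> * of_real \<alpha> * l + \<beta>"
    using fam by (auto simp: SL_family_def)
  have "norm (dy l 0) \<le> \<bar>\<alpha>\<bar> * norm l + norm \<beta>"
    unfolding y(3) by (rule norm_triangle_le) (simp add: norm_mult)
  also have "\<dots> \<le> \<bar>\<alpha>\<bar> * norm l + norm \<beta> * norm l" using mult_left_mono[OF l(1), of "norm \<beta>"] by simp
  finally have "norm (dy l 0) / norm l \<le> \<bar>\<alpha>\<bar> + norm \<beta>" using l(1)
    by (subst divide_le_eq) (auto simp: algebra_simps)
  then have "2 * (norm (y l 0) + norm (dy l 0) / norm l) * exp (\<bar>Im l\<bar> * \<bar>x - 0\<bar>) \<le> 2 * (1 + \<bar>\<alpha>\<bar> + norm \<beta>) * exp (\<bar>Im l\<bar> * \<bar>x - 0\<bar>)"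
    unfolding y(2) by (intro mult_right_mono) auto
  moreover have "norm (y l x) \<le> 2 * (norm (y l 0) + norm (dy l 0) / norm l) * exp (\<bar>Im l\<bar> * \<bar>x - 0\<bar>)"
    using l x by (intro SL_sol_bound[OF y(1) q]) auto
  ultimately have "norm (y l x) \<le> 2 * (1 + \<bar>\<alpha>\<bar> + norm \<beta>) * exp (\<bar>Im l\<bar> * \<bar>x - 0\<bar>)" by (rule order_trans[rotated])
  also have "\<bar>x - 0\<bar> = x" using x by simp
  finally show ?thesis .
qed

text \<open>
  For \<open>Im l = - \<tau>\<close> the solution is \<open>exp (i l b)\<close> times \<open>(1 + \<alpha>)/2\<close>, plus a recessive exponential, plus terms of order
  \<open>exp (\<tau> b) / |l|\<close>.  Since \<open>\<alpha> \<ge> 0\<close>, the leading factor is at least \<open>1/2\<close> and \<open>|1 - \<alpha>|\<close> does not exceed \<open>1 + \<alpha>\<close>.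
\<close>

lemma SL_family_lower_bound:
  assumes fam: "SL_family b q \<alpha> \<beta> y dy" and q: "q absolutely_integrable_on {0..b}" and \<alpha>: "\<alpha> \<ge> 0" and b: "b > 0"
  shows "\<exists>T\<ge>1. \<forall>l. Im l \<le> - T \<longrightarrow> norm (y l b) \<ge> exp (\<bar>Im l\<bar> * b) / 4"
proof -
  define K where "K = integral {0..b} (\<lambda>t. norm (q t))"
  have K: "K \<ge> 0" unfolding K_def using q by (intro integral_nonneg) (auto simp: absolutely_integrable_on_def)
  define A where "A = 1 + \<bar>\<alpha>\<bar> + norm \<beta>"
  have A: "A \<ge> 1" by (simp add: A_def)
  \<comment> \<open>\<open>T \<ge> 2/b\<close> makes the recessive exponential at most a fifth of the dominant one,
    and the last bound makes the error terms at most an eighth of it.\<close>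
  define T where "T = max (max 1 (2 * K)) (max (2 / b) (8 * (norm \<beta> + 2 * A * K)))"
  have T: "T \<ge> 1" "T \<ge> 2 * K" "T \<ge> 2 / b" "T \<ge> 8 * (norm \<beta> + 2 * A * K)" by (auto simp: T_def)
  have "norm (y l b) \<ge> exp (\<bar>Im l\<bar> * b) / 4" if l: "Im l \<le> - T" for l
  proof -
    define \<tau> where "\<tau> = \<bar>Im l\<bar>"
    have \<tau>: "\<tau> = - Im l" "\<tau> \<ge> T" using l T by (auto simp: \<tau>_def)
    have nl: "norm l \<ge> \<tau>" using abs_Im_le_cmod[of l] by (simp add: \<tau>_def)
    have l0: "l \<noteq> 0" "norm l \<ge> 1" "norm l \<ge> T" "norm l \<ge> 2 * K" using nl \<tau> T by auto
    have y: "SL_sol b q (l\<^sup>2) (y l) (dy l)" "y l 0 = 1" "dy l 0 = \<i> * of_real \<alpha> * l + \<beta>"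
      using fam by (auto simp: SL_family_def)
    define V where "V = dy l 0 * (sin (l * of_real (b - 0)) / l) + y l 0 * cos (l * of_real (b - 0))"
    have "norm (y l b - V) \<le> (2 * A) * exp (\<bar>Im l\<bar> * \<bar>b - 0\<bar>) * integral {0..b} (\<lambda>t. norm (q t)) / norm l"
      unfolding V_def
    proof (rule SL_sol_volterra[OF y(1) q l0(1)])
      fix t assume "t \<in> {0..b}"
      then show "norm (y l t) \<le> 2 * A * exp (\<bar>Im l\<bar> * \<bar>t - 0\<bar>)"
        using SL_family_bound[OF fam q, of l t] l0 by (simp add: A_def K_def)
    qed (use b in auto)
    then have 1: "norm (y l b - V) \<le> exp (\<tau> * b) * (2 * A * K / norm l)"
      using b by (simp add: \<tau>_def K_def mult_ac)
    define E E' where "E = exp (\<i> * (l * of_real b))" and "E' = exp (- (\<i> * (l * of_real b)))"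
    have nE: "norm E = exp (\<tau> * b)" "norm E' = exp (- (\<tau> * b))"
      by (simp_all add: E_def E'_def \<tau>(1))
    define B where "B = \<beta> * (sin (l * of_real b) / l)"
    have sn: "\<i> * sin (l * of_real b) = (E - E') / 2" "cos (l * of_real b) = (E + E') / 2"
      by (simp_all add: E_def E'_def exp_Euler exp_minus_Euler)
    have "V = of_real \<alpha> * (\<i> * sin (l * of_real b)) + cos (l * of_real b) + B"
      using l0 by (simp add: V_def y B_def field_simps)
    also have "\<dots> = of_real ((1 + \<alpha>) / 2) * E + of_real ((1 - \<alpha>) / 2) * E' + B"
      unfolding sn by (simp add: field_simps)
    finally have V: "V = of_real ((1 + \<alpha>) / 2) * E + of_real ((1 - \<alpha>) / 2) * E' + B" .
    have "norm B \<le> exp (\<tau> * b) * (norm \<beta> / norm l)"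
    proof -
      have "norm B = norm \<beta> / norm l * norm (sin (l * of_real b))" by (simp add: B_def norm_mult norm_divide)
      also have "\<dots> \<le> norm \<beta> / norm l * exp (\<tau> * b)"
        using norm_sin_le_exp_Im[of "l * of_real b"] b by (intro mult_left_mono) (auto simp: \<tau>_def abs_mult)
      finally show ?thesis by (simp add: mult.commute)
    qed
    moreover have "norm (of_real ((1 - \<alpha>) / 2) * E') \<le> (1 + \<alpha>) / 2 * (exp (\<tau> * b) / 5)"
    proof -
      have "2 * (\<tau> * b) \<ge> 4"
      proof -
        have "2 / b * b \<le> \<tau> * b" using T(3) \<tau>(2) b by (intro mult_right_mono) auto
        then show ?thesis using b by simp
      qed
      then have "5 \<le> exp (2 * (\<tau> * b))" using exp_ge_add_one_self[of "2 * (\<tau> * b)"] by linarith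
      then have "5 * exp (- (\<tau> * b)) \<le> exp (2 * (\<tau> * b)) * exp (- (\<tau> * b))" by (intro mult_right_mono) auto
      then have "exp (- (\<tau> * b)) \<le> exp (\<tau> * b) / 5" by (simp add: exp_add[symmetric])
      moreover have "\<bar>1 - \<alpha>\<bar> \<le> 1 + \<alpha>" using \<alpha> by auto
      ultimately show ?thesis unfolding norm_mult nE norm_of_real by (intro mult_mono) (auto simp: abs_divide)
    qed
    moreover have "norm (of_real ((1 + \<alpha>) / 2) * E) = (1 + \<alpha>) / 2 * exp (\<tau> * b)"
      using \<alpha> unfolding norm_mult nE norm_of_real by simp
    moreover have "norm (of_real ((1 + \<alpha>) / 2) * E) \<le> norm V + norm (of_real ((1 - \<alpha>) / 2) * E') + norm B"
    proof -
      have "of_real ((1 + \<alpha>) / 2) * E = V - of_real ((1 - \<alpha>) / 2) * E' - B" unfolding V by simp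
      then have "norm (of_real ((1 + \<alpha>) / 2) * E) = norm (V - of_real ((1 - \<alpha>) / 2) * E' - B)" by (rule arg_cong)
      then show ?thesis
        using norm_triangle_ineq4[of V "of_real ((1 - \<alpha>) / 2) * E'"] norm_triangle_ineq4[of "V - of_real ((1 - \<alpha>) / 2) * E'" B]
        by linarith
    qed
    ultimately have 2: "(1 + \<alpha>) / 2 * exp (\<tau> * b) \<le> norm V + (1 + \<alpha>) / 2 * (exp (\<tau> * b) / 5) + exp (\<tau> * b) * (norm \<beta> / norm l)"
      by linarith
    have 3: "norm V \<le> norm (y l b) + exp (\<tau> * b) * (2 * A * K / norm l)"
      using 1 norm_triangle_ineq2[of V "y l b"] by (simp add: norm_minus_commute)
    have "norm \<beta> / norm l + 2 * A * K / norm l \<le> 1/8"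
    proof -
      have "norm \<beta> + 2 * A * K \<le> norm l / 8" using l0(3) T(4) by simp
      then show ?thesis using l0 by (simp add: add_divide_distrib[symmetric] divide_le_eq)
    qed
    then have 4: "exp (\<tau> * b) * (norm \<beta> / norm l + 2 * A * K / norm l) \<le> exp (\<tau> * b) * (1/8)"
      by (intro mult_left_mono) auto
    \<comment> \<open>The dominant term is at least \<open>X/2\<close>; it loses at most a fifth of itself to the recessive one and
      at most \<open>X/8\<close> to the errors, so more than \<open>X/4\<close> is left.\<close>
    define X where "X = exp (\<tau> * b)"
    have "X > 0" by (simp add: X_def)
    moreover have "X * (1 + \<alpha>) \<ge> X" using \<alpha> by (simp add: X_def)
    moreover have "X * (1 + \<alpha>) / 2 \<le> norm V + X * (1 + \<alpha>) / 10 + X * (norm \<beta> / norm l)"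
      using 2 by (simp add: X_def mult.commute)
    moreover have "X * (norm \<beta> / norm l) + X * (2 * A * K / norm l) \<le> X * (1/8)"
      using 4 unfolding X_def distrib_left .
    ultimately have "norm (y l b) \<ge> exp (\<tau> * b) / 4" using 3 unfolding X_def[symmetric] by linarith
    then show ?thesis by (simp add: \<tau>_def)
  qed
  then show ?thesis using T(1) by blast
qed

lemma entire_bounded_on_cball:
  assumes "f holomorphic_on UNIV"
  obtains B where "B \<ge> 0" "\<And>z. norm z \<le> R \<Longrightarrow> norm (f z :: complex) \<le> B"
proof -
  have "continuous_on (cball 0 R) f" using assms by (auto intro: holomorphic_on_imp_continuous_on continuous_on_subset)
  then have "bounded (f ` cball 0 R)" by (intro compact_imp_bounded compact_continuous_image) auto
  then obtain B where "\<And>z. z \<in> cball 0 R \<Longrightarrow> norm (f z) \<le> B" unfolding bounded_iff by blast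
  then show ?thesis by (intro that[of "max B 0"]) (auto simp: le_max_iff_disj)
qed

text \<open>
  The Wronskian at \<open>b\<close> is its value at \<open>0\<close>, which is affine in \<open>l\<close>, plus the integral of \<open>(p - q) y z\<close>; so
  the growth follows from that of \<open>y\<close> and \<open>z\<close>.  Small \<open>l\<close> are covered by compactness.
\<close>

lemma wronskian_growth:
  assumes y: "SL_family b q \<alpha> \<beta> y dy" and q: "q absolutely_integrable_on {0..b}"
    and z: "SL_family b p \<alpha>' \<beta>' z dz" and p: "p absolutely_integrable_on {0..b}" and b: "b > 0"
  shows "\<exists>K. \<forall>l. norm (y l b * dz l b - dy l b * z l b) \<le> K * (1 + norm l) * exp (2 * b * \<bar>Im l\<bar>)"
proof -
  define W where "W l = y l b * dz l b - dy l b * z l b" for l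
  define R where "R = max 1 (max (2 * integral {0..b} (\<lambda>t. norm (q t))) (2 * integral {0..b} (\<lambda>t. norm (p t))))"
  have hol: "W holomorphic_on UNIV" unfolding W_def
    using b by (intro holomorphic_intros SL_family_holomorphic[OF y q] SL_family_holomorphic[OF z p]) auto
  obtain B where B: "B \<ge> 0" "\<And>l. norm l \<le> R \<Longrightarrow> norm (W l) \<le> B" using entire_bounded_on_cball[OF hol] by metis
  define P where "P = integral {0..b} (\<lambda>t. norm (p t - q t))"
  have pq: "(\<lambda>t. p t - q t) absolutely_integrable_on {0..b}" using p q by (intro set_integral_diff)
  then have P: "P \<ge> 0" unfolding P_def by (intro integral_nonneg) (auto simp: absolutely_integrable_on_def)
  define A A' where "A = 2 * (1 + \<bar>\<alpha>\<bar> + norm \<beta>)" and "A' = 2 * (1 + \<bar>\<alpha>'\<bar> + norm \<beta>')"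
  have A: "A \<ge> 0" "A' \<ge> 0" by (auto simp: A_def A'_def)
  define K where "K = B + (\<bar>\<alpha>' - \<alpha>\<bar> + norm (\<beta>' - \<beta>)) + P * (A * A')"
  have "norm (W l) \<le> K * (1 + norm l) * exp (2 * b * \<bar>Im l\<bar>)" for l
  proof -
    have ge1: "1 \<le> exp (2 * b * \<bar>Im l\<bar>)" using b by simp
    have "norm (W l) \<le> B + (\<bar>\<alpha>' - \<alpha>\<bar> + norm (\<beta>' - \<beta>)) * (1 + norm l) + P * (A * A') * exp (2 * b * \<bar>Im l\<bar>)"
    proof (cases "norm l \<le> R")
      case True
      then have "norm (W l) \<le> B" by (rule B)
      then show ?thesis using P A by (simp add: add_increasing2)
    next
      case False
      then have l: "norm l \<ge> 1" "norm l \<ge> 2 * integral {0..b} (\<lambda>t. norm (q t))" "norm l \<ge> 2 * integral {0..b} (\<lambda>t. norm (p t))"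
        by (auto simp: R_def)
      have yl: "SL_sol b q (l\<^sup>2) (y l) (dy l)" "y l 0 = 1" "dy l 0 = \<i> * of_real \<alpha> * l + \<beta>" using y by (auto simp: SL_family_def)
      have zl: "SL_sol b p (l\<^sup>2) (z l) (dz l)" "z l 0 = 1" "dz l 0 = \<i> * of_real \<alpha>' * l + \<beta>'" using z by (auto simp: SL_family_def)
      note ac = wronskian_ac_deriv[OF yl(1) zl(1)]
      have "W l = (dz l 0 - dy l 0) + integral {0..b} (\<lambda>x. (p x - q x) * (y l x * z l x))"
        using ac_deriv_diff[OF ac, of 0 b] b by (simp add: W_def yl(2) zl(2) algebra_simps)
      then have "norm (W l) \<le> norm (dz l 0 - dy l 0) + norm (integral {0..b} (\<lambda>x. (p x - q x) * (y l x * z l x)))"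
        by (simp add: norm_triangle_ineq)
      moreover have "norm (dz l 0 - dy l 0) \<le> (\<bar>\<alpha>' - \<alpha>\<bar> + norm (\<beta>' - \<beta>)) * (1 + norm l)"
      proof -
        have "dz l 0 - dy l 0 = \<i> * of_real (\<alpha>' - \<alpha>) * l + (\<beta>' - \<beta>)" by (simp add: yl zl algebra_simps)
        also have "norm \<dots> \<le> \<bar>\<alpha>' - \<alpha>\<bar> * norm l + norm (\<beta>' - \<beta>)"
          by (rule norm_triangle_le) (simp add: norm_mult del: of_real_diff)
        also have "\<dots> \<le> (\<bar>\<alpha>' - \<alpha>\<bar> + norm (\<beta>' - \<beta>)) * (1 + norm l)" by (simp add: algebra_simps)
        finally show ?thesis .
      qed
      moreover have "norm (integral {0..b} (\<lambda>x. (p x - q x) * (y l x * z l x))) \<le> integral {0..b} (\<lambda>x. norm (p x - q x) * (A * A' * exp (2 * b * \<bar>Im l\<bar>)))"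
      proof (rule integral_norm_bound_integral)
        show "(\<lambda>x. (p x - q x) * (y l x * z l x)) integrable_on {0..b}" by (rule ac_deriv_HK_integrable[OF ac])
        show "(\<lambda>x. norm (p x - q x) * (A * A' * exp (2 * b * \<bar>Im l\<bar>))) integrable_on {0..b}"
          using pq by (intro integrable_on_mult_left) (auto simp: absolutely_integrable_on_def)
        fix x assume x: "x \<in> {0..b}"
        have ex: "exp (\<bar>Im l\<bar> * x) \<le> exp (\<bar>Im l\<bar> * b)" using x by (auto intro: mult_left_mono)
        have "norm (y l x) \<le> A * exp (\<bar>Im l\<bar> * b)"
          using SL_family_bound[OF y q l(1,2) x] mult_left_mono[OF ex A(1)] by (simp add: A_def)
        moreover have "norm (z l x) \<le> A' * exp (\<bar>Im l\<bar> * b)"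
          using SL_family_bound[OF z p l(1,3) x] mult_left_mono[OF ex A(2)] by (simp add: A'_def)
        ultimately have "norm (y l x * z l x) \<le> (A * exp (\<bar>Im l\<bar> * b)) * (A' * exp (\<bar>Im l\<bar> * b))"
          unfolding norm_mult using A by (intro mult_mono) auto
        also have "\<dots> = A * A' * exp (2 * b * \<bar>Im l\<bar>)" by (simp add: exp_add[symmetric] mult_ac)
        finally show "norm ((p x - q x) * (y l x * z l x)) \<le> norm (p x - q x) * (A * A' * exp (2 * b * \<bar>Im l\<bar>))"
          unfolding norm_mult[of "p x - q x"] by (intro mult_left_mono) auto
      qed
      moreover have "integral {0..b} (\<lambda>x. norm (p x - q x) * (A * A' * exp (2 * b * \<bar>Im l\<bar>))) = P * (A * A') * exp (2 * b * \<bar>Im l\<bar>)"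
        by (simp add: P_def mult.assoc)
      ultimately show ?thesis using B(1) by linarith
    qed
    also have "\<dots> \<le> B * (1 + norm l) * exp (2 * b * \<bar>Im l\<bar>) + (\<bar>\<alpha>' - \<alpha>\<bar> + norm (\<beta>' - \<beta>)) * (1 + norm l) * exp (2 * b * \<bar>Im l\<bar>)
        + P * (A * A') * (1 + norm l) * exp (2 * b * \<bar>Im l\<bar>)"
    proof (intro add_mono)
      have "1 * 1 \<le> (1 + norm l) * exp (2 * b * \<bar>Im l\<bar>)" using ge1 by (intro mult_mono) auto
      then have "B * 1 \<le> B * ((1 + norm l) * exp (2 * b * \<bar>Im l\<bar>))" using B(1) by (intro mult_left_mono) auto
      then show "B \<le> B * (1 + norm l) * exp (2 * b * \<bar>Im l\<bar>)" by (simp add: mult.assoc)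
      have "(\<bar>\<alpha>' - \<alpha>\<bar> + norm (\<beta>' - \<beta>)) * (1 + norm l) * 1 \<le> (\<bar>\<alpha>' - \<alpha>\<bar> + norm (\<beta>' - \<beta>)) * (1 + norm l) * exp (2 * b * \<bar>Im l\<bar>)"
        using ge1 by (intro mult_left_mono) auto
      then show "(\<bar>\<alpha>' - \<alpha>\<bar> + norm (\<beta>' - \<beta>)) * (1 + norm l) \<le> (\<bar>\<alpha>' - \<alpha>\<bar> + norm (\<beta>' - \<beta>)) * (1 + norm l) * exp (2 * b * \<bar>Im l\<bar>)" by simp
      have "P * (A * A') * 1 \<le> P * (A * A') * (1 + norm l)" using P A by (intro mult_left_mono) auto
      then show "P * (A * A') * exp (2 * b * \<bar>Im l\<bar>) \<le> P * (A * A') * (1 + norm l) * exp (2 * b * \<bar>Im l\<bar>)" by (intro mult_right_mono) auto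
    qed
    also have "\<dots> = K * (1 + norm l) * exp (2 * b * \<bar>Im l\<bar>)" by (simp only: K_def distrib_right)
    finally show ?thesis .
  qed
  then show ?thesis unfolding W_def by blast
qed

text \<open>
  Evenness carries the decay in the lower half-plane \<open>Im l \<le> - T\<close> over to the upper one, and in the remaining strip the
  function is bounded outside a disc by assumption, so Liouville's theorem applies.  The constant is the limit along the negative imaginary axis.
\<close>

lemma even_entire_decay_imp_zero:
  assumes hol: "D holomorphic_on UNIV" and even: "\<And>l. D (- l) = D l" and T: "T \<ge> 1"
    and le1: "\<And>l. Im l \<le> - T \<Longrightarrow> norm (D l) \<le> B / norm l"
    and le2: "\<And>l. norm l \<ge> R \<Longrightarrow> \<bar>Im l\<bar> \<le> T \<Longrightarrow> norm (D l) \<le> B'"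
  shows "D l = 0"
proof -
  obtain B0 where B0: "\<And>l. norm l \<le> R \<Longrightarrow> norm (D l) \<le> B0" using entire_bounded_on_cball[OF hol] by metis
  have low: "norm (D l) \<le> \<bar>B\<bar>" if "Im l \<le> - T" for l
  proof -
    have "norm l \<ge> 1" using abs_Im_le_cmod[of l] that T by auto
    then have "B \<le> \<bar>B\<bar> * norm l" using mult_left_mono[of 1 "norm l" "\<bar>B\<bar>"] by linarith
    then have "B / norm l \<le> \<bar>B\<bar>" using \<open>norm l \<ge> 1\<close> by (subst divide_le_eq) auto
    then show ?thesis using le1[OF that] by linarith
  qed
  have "norm (D l) \<le> max (max B0 B') \<bar>B\<bar>" for l
  proof -
    consider "norm l \<le> R" | "Im l \<le> - T" | "Im (- l) \<le> - T" | "norm l \<ge> R" "\<bar>Im l\<bar> \<le> T" by fastforce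
    then show ?thesis
    proof cases
      case 3
      from low[OF this] show ?thesis unfolding even by simp
    qed (use B0[of l] low[of l] le2[of l] in auto)
  qed
  then have "bounded (range D)" unfolding bounded_iff by blast
  then obtain c where c: "\<And>l. D l = c" using Liouville_theorem[OF hol] by (auto simp: constant_on_def)
  have "norm c \<le> 0 + e" if "e > 0" for e
  proof -
    define t where "t = max T (\<bar>B\<bar> / e)"
    have t: "t \<ge> T" "t \<ge> \<bar>B\<bar> / e" "t > 0" using T by (auto simp: t_def)
    have "norm (D (- \<i> * of_real t)) \<le> B / norm (- \<i> * of_real t)" using t by (intro le1) auto
    then have "norm c \<le> B / t" using t by (simp add: c norm_mult)
    also have "\<dots> \<le> e" using t that by (auto simp: field_simps)
    finally show ?thesis by simp
  qed
  then have "norm c \<le> 0" by (rule field_le_epsilon)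
  then show ?thesis by (simp add: c)
qed

section \<open>Uniqueness from the Weyl quotient at an interior point\<close>

text \<open>
  Expanding \<open>y\<close> and \<open>z\<close> at \<open>b\<close>, the terms containing \<open>y'(b)\<close> and \<open>z'(b)\<close> combine to a multiple of the Wronskian at \<open>b\<close>.  So
  \<open>D = C S' - C' S\<close> is expressed by \<open>y(x)/y(b)\<close> and \<open>z(x)/z(b)\<close>, which decay in the lower half-plane.
\<close>

lemma cross_product_vanishes:
  assumes y: "SL_family b q \<alpha> \<beta> y dy" and q: "q absolutely_integrable_on {0..b}" and \<alpha>: "\<alpha> \<ge> 0"
    and z: "SL_family b p \<alpha>' \<beta>' z dz" and p: "p absolutely_integrable_on {0..b}" and \<alpha>': "\<alpha>' \<ge> 0" and b: "b > 0"
    and W: "\<And>l. y l b * dz l b - dy l b * z l b = 0"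
    and C: "\<And>\<mu>. SL_sol b q \<mu> (C \<mu>) (dC \<mu>)" "\<And>\<mu>. C \<mu> b = 1" "\<And>\<mu>. dC \<mu> b = 0"
    and S: "\<And>\<mu>. SL_sol b q \<mu> (S \<mu>) (dS \<mu>)" "\<And>\<mu>. S \<mu> b = 0" "\<And>\<mu>. dS \<mu> b = 1"
    and C': "\<And>\<mu>. SL_sol b p \<mu> (C' \<mu>) (dC' \<mu>)" "\<And>\<mu>. C' \<mu> b = 1" "\<And>\<mu>. dC' \<mu> b = 0"
    and S': "\<And>\<mu>. SL_sol b p \<mu> (S' \<mu>) (dS' \<mu>)" "\<And>\<mu>. S' \<mu> b = 0" "\<And>\<mu>. dS' \<mu> b = 1"
    and x: "x \<in> {0..b}"
    and hol: "(\<lambda>\<mu>. C \<mu> x) holomorphic_on UNIV" "(\<lambda>\<mu>. S \<mu> x) holomorphic_on UNIV"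
      "(\<lambda>\<mu>. C' \<mu> x) holomorphic_on UNIV" "(\<lambda>\<mu>. S' \<mu> x) holomorphic_on UNIV"
  shows "C (l\<^sup>2) x * S' (l\<^sup>2) x = C' (l\<^sup>2) x * S (l\<^sup>2) x"
proof -
  \<comment> \<open>Only \<open>l\<^sup>2\<close> enters, so \<open>D\<close> is even although \<open>y\<close> and \<open>z\<close> are not.\<close>
  define D where "D l = C (l\<^sup>2) x * S' (l\<^sup>2) x - C' (l\<^sup>2) x * S (l\<^sup>2) x" for l
  define R where "R = max 1 (max (2 * integral {0..b} (\<lambda>t. norm (q t))) (2 * integral {0..b} (\<lambda>t. norm (p t))))"
  have bb: "b \<in> {0..b}" using b by simp
  have yl: "SL_sol b q (l\<^sup>2) (y l) (dy l)" and zl: "SL_sol b p (l\<^sup>2) (z l) (dz l)" for l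
    using y z by (auto simp: SL_family_def)
  have R: "norm l \<ge> 1" "norm l \<ge> 2 * integral {0..b} (\<lambda>t. norm (q t))" "norm l \<ge> 2 * integral {0..b} (\<lambda>t. norm (p t))" "l \<noteq> 0"
    if "norm l \<ge> R" for l :: complex using that by (auto simp: R_def)
  define e where "e l = exp (\<bar>Im l\<bar> * (b - x))" for l
  have xb: "\<bar>x - b\<bar> = b - x" using x by auto
  have bC: "norm (C (l\<^sup>2) x) \<le> 2 * e l" "norm (C' (l\<^sup>2) x) \<le> 2 * e l"
    and bS: "norm (S (l\<^sup>2) x) \<le> 2 / norm l * e l" "norm (S' (l\<^sup>2) x) \<le> 2 / norm l * e l" if "norm l \<ge> R" for l
    using SL_sol_bound[OF C(1) q R(4) R(2) bb x, OF that that] SL_sol_bound[OF C'(1) p R(4) R(3) bb x, OF that that]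
      SL_sol_bound[OF S(1) q R(4) R(2) bb x, OF that that] SL_sol_bound[OF S'(1) p R(4) R(3) bb x, OF that that]
    by (simp_all add: C C' S S' e_def xb)
  obtain T1 where T1: "T1 \<ge> 1" "\<And>l. Im l \<le> - T1 \<Longrightarrow> norm (y l b) \<ge> exp (\<bar>Im l\<bar> * b) / 4"
    using SL_family_lower_bound[OF y q \<alpha> b] by blast
  obtain T2 where T2: "T2 \<ge> 1" "\<And>l. Im l \<le> - T2 \<Longrightarrow> norm (z l b) \<ge> exp (\<bar>Im l\<bar> * b) / 4"
    using SL_family_lower_bound[OF z p \<alpha>' b] by blast
  define T where "T = max R (max T1 T2)"
  have T: "T \<ge> 1" "T \<ge> R" "T \<ge> T1" "T \<ge> T2" using T1 by (auto simp: T_def)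
  define A A' where "A = 2 * (1 + \<bar>\<alpha>\<bar> + norm \<beta>)" and "A' = 2 * (1 + \<bar>\<alpha>'\<bar> + norm \<beta>')"
  have A: "A \<ge> 0" "A' \<ge> 0" by (auto simp: A_def A'_def)
  have "D l = 0" for l
  proof (rule even_entire_decay_imp_zero[where D = D])
    have sq: "(\<lambda>l. f (l\<^sup>2)) holomorphic_on UNIV" if "f holomorphic_on UNIV" for f :: "complex \<Rightarrow> complex"
      by (rule holomorphic_on_compose_gen[of "\<lambda>l. l\<^sup>2", OF _ that, unfolded o_def]) (auto intro!: holomorphic_intros)
    show "D holomorphic_on UNIV" unfolding D_def by (intro holomorphic_intros hol[THEN sq])
    show "D (- l) = D l" for l by (simp add: D_def)
    show "T \<ge> 1" by (rule T)
    show "norm (D l) \<le> (8 * A + 8 * A') / norm l" if l: "Im l \<le> - T" for l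
    proof -
      have nR: "norm l \<ge> R" using abs_Im_le_cmod[of l] l T by auto
      define E where "E = exp (\<bar>Im l\<bar> * b)"
      have E: "E > 0" "exp (\<bar>Im l\<bar> * x) * e l = E"
        by (auto simp: E_def e_def exp_add[symmetric] algebra_simps)
      have ge: "norm (y l b) \<ge> E / 4" "norm (z l b) \<ge> E / 4"
        using T1(2)[of l] T2(2)[of l] l T by (auto simp: E_def)
      have nz: "norm (y l b) > 0" "norm (z l b) > 0" using ge E by linarith+
      have yx: "norm (y l x) \<le> A * exp (\<bar>Im l\<bar> * x)" "norm (z l x) \<le> A' * exp (\<bar>Im l\<bar> * x)"
        using SL_family_bound[OF y q R(1,2)[OF nR] x] SL_family_bound[OF z p R(1,3)[OF nR] x] by (auto simp: A_def A'_def)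
      have ex: "y l x = y l b * C (l\<^sup>2) x + dy l b * S (l\<^sup>2) x" "z l x = z l b * C' (l\<^sup>2) x + dz l b * S' (l\<^sup>2) x"
        using SL_sol_expand(1)[OF yl C(1) S(1) bb C(2,3) S(2,3) x] SL_sol_expand(1)[OF zl C'(1) S'(1) bb C'(2,3) S'(2,3) x] by auto
      have "y l b * z l b * D l = y l x * S' (l\<^sup>2) x * z l b - z l x * S (l\<^sup>2) x * y l b
              + (y l b * dz l b - dy l b * z l b) * (S (l\<^sup>2) x * S' (l\<^sup>2) x)"
        unfolding ex D_def by (simp add: algebra_simps)
      also have "\<dots> = y l x * S' (l\<^sup>2) x * z l b - z l x * S (l\<^sup>2) x * y l b" by (simp add: W)
      finally have "norm (y l b) * norm (z l b) * norm (D l) = norm (y l x * S' (l\<^sup>2) x * z l b - z l x * S (l\<^sup>2) x * y l b)"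
        by (metis norm_mult)
      also have "\<dots> \<le> norm (y l x) * norm (S' (l\<^sup>2) x) * norm (z l b) + norm (z l x) * norm (S (l\<^sup>2) x) * norm (y l b)"
        by (metis norm_mult norm_triangle_ineq4)
      also have "\<dots> \<le> (A * exp (\<bar>Im l\<bar> * x)) * (2 / norm l * e l) * norm (z l b) + (A' * exp (\<bar>Im l\<bar> * x)) * (2 / norm l * e l) * norm (y l b)"
        using A by (intro add_mono mult_mono yx bS nR) (auto simp: e_def)
      also have "\<dots> = (exp (\<bar>Im l\<bar> * x) * e l) * (2 * A / norm l) * norm (z l b) + (exp (\<bar>Im l\<bar> * x) * e l) * (2 * A' / norm l) * norm (y l b)"
        by (simp add: mult_ac)
      also have "\<dots> = E * (2 * A / norm l) * norm (z l b) + E * (2 * A' / norm l) * norm (y l b)" by (simp only: E(2))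
      also have "\<dots> \<le> (4 * norm (y l b)) * (2 * A / norm l) * norm (z l b) + (4 * norm (z l b)) * (2 * A' / norm l) * norm (y l b)"
        using ge A by (intro add_mono mult_right_mono) auto
      also have "\<dots> = norm (y l b) * norm (z l b) * ((8 * A + 8 * A') / norm l)" by (simp add: add_divide_distrib algebra_simps)
      finally show ?thesis using nz by (simp only: mult_le_cancel_left_pos mult_pos_pos)
    qed
    show "norm (D l) \<le> 8 * exp (2 * T * b)" if l: "norm l \<ge> R" "\<bar>Im l\<bar> \<le> T" for l
    proof -
      have "\<bar>Im l\<bar> * (b - x) \<le> T * b" using l x T by (intro mult_mono) auto
      then have eT: "e l \<le> exp (T * b)" by (simp add: e_def)
      have e0: "e l > 0" by (simp add: e_def)
      have "2 / norm l \<le> 2" using R(1)[OF l(1)] by (subst divide_le_eq) auto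
      then have "2 / norm l * e l \<le> 2 * e l" using e0 by (intro mult_right_mono) auto
      then have bS': "norm (S (l\<^sup>2) x) \<le> 2 * e l" "norm (S' (l\<^sup>2) x) \<le> 2 * e l" using bS[OF l(1)] by auto
      have "norm (D l) \<le> norm (C (l\<^sup>2) x) * norm (S' (l\<^sup>2) x) + norm (C' (l\<^sup>2) x) * norm (S (l\<^sup>2) x)"
        unfolding D_def by (metis norm_mult norm_triangle_ineq4)
      also have "\<dots> \<le> (2 * e l) * (2 * e l) + (2 * e l) * (2 * e l)"
        using e0 by (intro add_mono mult_mono bC bS' l(1)) auto
      also have "\<dots> = 8 * (e l * e l)" by simp
      also have "\<dots> \<le> 8 * (exp (T * b) * exp (T * b))" using eT e0 by (intro mult_left_mono mult_mono) auto
      also have "\<dots> = 8 * exp (2 * T * b)" by (simp add: exp_add[symmetric])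
      finally show ?thesis .
    qed
  qed
  then show ?thesis by (simp add: D_def)
qed

lemma has_vector_derivative_mult_commuted:
  fixes f g :: "real \<Rightarrow> complex"
  assumes "(f has_vector_derivative f') (at x within S)" "(g has_vector_derivative g') (at x within S)"
  shows "((\<lambda>t. f t * g t) has_vector_derivative (f' * g x + f x * g')) (at x within S)"
  using has_vector_derivative_mult[OF assms] by (simp add: add.commute)

text \<open>
  Zeros with nonvanishing derivative are isolated, and an infinite set of zeros would accumulate in \<open>[0,b]\<close>.
\<close>

lemma simple_zeros_finite:
  fixes f :: "real \<Rightarrow> complex"
  assumes d: "\<And>x. x \<in> {0..b} \<Longrightarrow> (f has_vector_derivative df x) (at x within {0..b})"
    and nz: "\<And>x. x \<in> {0..b} \<Longrightarrow> f x = 0 \<Longrightarrow> df x \<noteq> 0"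
  shows "finite {x\<in>{0..b}. f x = 0}"
proof (rule ccontr)
  define Z where "Z = {x\<in>{0..b}. f x = 0}"
  assume "infinite {x\<in>{0..b}. f x = 0}"
  then have "infinite Z \<and> Z \<subseteq> {0..b}" by (auto simp: Z_def)
  then obtain x where x: "x \<in> {0..b}" "x islimpt Z"
    using compact_Icc[of 0 b] unfolding compact_eq_Bolzano_Weierstrass by blast
  have "\<exists>d>0. \<forall>t\<in>{0..b}. t \<noteq> x \<and> dist t x < d \<longrightarrow> f t \<noteq> 0"
  proof (cases "f x = 0")
    case False
    have "continuous (at x within {0..b}) f" using d[OF x(1)] by (rule has_vector_derivative_continuous)
    then obtain d where "d > 0" "\<forall>t\<in>{0..b}. dist t x < d \<longrightarrow> dist (f t) (f x) < norm (f x)"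
      using False unfolding continuous_within_eps_delta by (meson zero_less_norm_iff)
    then show ?thesis by (intro exI[of _ d]) (auto simp: dist_norm)
  next
    case True
    then have dx: "df x \<noteq> 0" using nz x by blast
    obtain d where d: "d > 0" "\<forall>t\<in>{0..b}. norm (t - x) < d \<longrightarrow>
        norm (f t - f x - (t - x) *\<^sub>R df x) \<le> norm (df x) / 2 * norm (t - x)"
      using d[OF x(1)] dx unfolding has_vector_derivative_def has_derivative_within_alt
      by (metis half_gt_zero zero_less_norm_iff)
    have "f t \<noteq> 0" if t: "t \<in> {0..b}" "t \<noteq> x" "dist t x < d" for t
    proof
      assume "f t = 0"
      then have "norm ((t - x) *\<^sub>R df x) \<le> norm (df x) / 2 * norm (t - x)"
        using d(2) t True by (auto simp: dist_norm)
      then have "\<bar>t - x\<bar> * norm (df x) \<le> \<bar>t - x\<bar> * (norm (df x) / 2)" by (simp add: mult.commute)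
      then have "norm (df x) \<le> norm (df x) / 2" using t by (subst (asm) mult_le_cancel_left_pos) auto
      then show False using dx by simp
    qed
    then show ?thesis using d(1) by blast
  qed
  then show False using x(2) unfolding islimpt_approachable Z_def by blast
qed

text \<open>
  The cross product equation says that \<open>C/S\<close> and \<open>C'/S'\<close> agree.  The derivatives of these quotients are \<open>- 1/S\<^sup>2\<close> and
  \<open>- 1/S'\<^sup>2\<close>, so \<open>S'\<^sup>2 = S\<^sup>2\<close>.  Two further derivatives bring in the potentials, multiplied by \<open>S\<^sup>2\<close>, which has only
  finitely many zeros.  Everything is done with denominators cleared.
\<close>

lemma potential_determined:
  assumes b: "b > 0"
    and C: "SL_sol b q \<mu> C dC" "C b = 1" "dC b = 0" and S: "SL_sol b q \<mu> S dS" "S b = 0" "dS b = 1"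
    and C': "SL_sol b p \<mu> C' dC'" "C' b = 1" "dC' b = 0" and S': "SL_sol b p \<mu> S' dS'" "S' b = 0" "dS' b = 1"
    and eq: "\<And>x. x \<in> {0..b} \<Longrightarrow> C x * S' x = C' x * S x"
  shows "\<exists>N. negligible N \<and> (\<forall>x\<in>{0<..<b} - N. p x = q x)"
proof -
  have bb: "b \<in> {0..b}" using b by simp
  have der: "(f has_vector_derivative df x) (at x within {0..b})" if "SL_sol b r \<mu> f df" "x \<in> {0..b}" for r f df x
    using that ac_deriv_has_vector_derivative[of b f df x] ac_deriv_continuous[of b df] by (auto simp: SL_sol_def)
  have uniq: "u = v" if "(f has_vector_derivative u) (at x within {0..b})" "(f has_vector_derivative v) (at x within {0..b})" "x \<in> {0..b}"
    for f :: "real \<Rightarrow> complex" and u v x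
    using vector_derivative_unique_within_closed_interval[of 0 b x f u v] that b by simp
  have congd: "(g has_vector_derivative u) (at x within {0..b})"
    if "(f has_vector_derivative u) (at x within {0..b})" "\<And>t. t \<in> {0..b} \<Longrightarrow> f t = g t" "x \<in> {0..b}"
    for f g :: "real \<Rightarrow> complex" and u x
    using that by (metis has_vector_derivative_transform)
  have w: "C x * dS x - dC x * S x = 1" "C' x * dS' x - dC' x * S' x = 1" if "x \<in> {0..b}" for x
    using wronskian_const[OF C(1) S(1) that bb] wronskian_const[OF C'(1) S'(1) that bb] by (simp_all add: C C' S S')
  have e2: "dC x * S' x + C x * dS' x = dC' x * S x + C' x * dS x" if x: "x \<in> {0..b}" for x
  proof (rule uniq[OF _ _ x])
    show "((\<lambda>t. C' t * S t) has_vector_derivative dC' x * S x + C' x * dS x) (at x within {0..b})"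
      by (intro has_vector_derivative_mult_commuted der[OF C'(1)] der[OF S(1)] x)
    have "((\<lambda>t. C t * S' t) has_vector_derivative dC x * S' x + C x * dS' x) (at x within {0..b})"
      by (intro has_vector_derivative_mult_commuted der[OF C(1)] der[OF S'(1)] x)
    then show "((\<lambda>t. C' t * S t) has_vector_derivative dC x * S' x + C x * dS' x) (at x within {0..b})"
      by (rule congd[OF _ eq x])
  qed
  \<comment> \<open>Multiply \<open>S'\<^sup>2\<close> by the first Wronskian and \<open>S\<^sup>2\<close> by the second: by \<open>eq\<close>, the difference is
    a multiple of the relation \<open>e2\<close>.\<close>
  have sq: "S' x * S' x = S x * S x" if x: "x \<in> {0..b}" for x
    using eq[OF x] e2[OF x] w[OF x] by algebra
  have e3: "S' x * dS' x = S x * dS x" if x: "x \<in> {0..b}" for x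
  proof -
    have "dS' x * S' x + S' x * dS' x = dS x * S x + S x * dS x"
    proof (rule uniq[OF _ _ x])
      show "((\<lambda>t. S t * S t) has_vector_derivative dS x * S x + S x * dS x) (at x within {0..b})"
        by (intro has_vector_derivative_mult_commuted der[OF S(1)] x)
      have "((\<lambda>t. S' t * S' t) has_vector_derivative dS' x * S' x + S' x * dS' x) (at x within {0..b})"
        by (intro has_vector_derivative_mult_commuted der[OF S'(1)] x)
      then show "((\<lambda>t. S t * S t) has_vector_derivative dS' x * S' x + S' x * dS' x) (at x within {0..b})"
        by (rule congd[OF _ sq x])
    qed
    then show ?thesis by (simp add: mult.commute)
  qed
  have "ac_deriv b (\<lambda>x. S' x * dS' x + - (S x * dS x))
      (\<lambda>x. (dS' x * dS' x + S' x * ((p x - \<mu>) * S' x)) + - (dS x * dS x + S x * ((q x - \<mu>) * S x)))"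
    using S S' unfolding SL_sol_def by (intro ac_deriv_add ac_deriv_minus ac_deriv_mult) auto
  then obtain N where N: "negligible N"
    "\<And>x. x \<in> {0<..<b} - N \<Longrightarrow> (dS' x * dS' x + S' x * ((p x - \<mu>) * S' x)) + - (dS x * dS x + S x * ((q x - \<mu>) * S x)) = 0"
    using ac_deriv_zero_imp_ae_zero[of b "\<lambda>x. S' x * dS' x + - (S x * dS x)"] e3 by force
  define Z where "Z = {x\<in>{0..b}. S x = 0}"
  have "finite Z" unfolding Z_def
  proof (rule simple_zeros_finite[OF der[OF S(1)]])
    show "dS x \<noteq> 0" if "x \<in> {0..b}" "S x = 0" for x using w(1)[OF that(1)] that(2) by auto
  qed
  then have "negligible (N \<union> Z)" using N(1) by (simp add: negligible_Un negligible_finite)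
  moreover have "p x = q x" if x: "x \<in> {0<..<b} - (N \<union> Z)" for x
  proof -
    have x': "x \<in> {0..b}" using x by auto
    have S0: "S x \<noteq> 0" using x by (auto simp: Z_def)
    have "(S x * S x) * (dS' x * dS' x) = (S x * S x) * (dS x * dS x)"
      using sq[OF x'] e3[OF x'] by algebra
    then have "dS' x * dS' x = dS x * dS x" using S0 by simp
    moreover have "(dS' x * dS' x + S' x * ((p x - \<mu>) * S' x)) + - (dS x * dS x + S x * ((q x - \<mu>) * S x)) = 0"
      using x by (intro N(2)) auto
    ultimately have "(p x - q x) * (S x * S x) = 0" using sq[OF x'] by algebra
    then show ?thesis using S0 by simp
  qed
  ultimately show ?thesis by blast
qed

text \<open>
  The potential is read off at the single spectral value \<open>\<mu> = 0\<close>; the other values of \<open>l\<close> serve to make the cross product vanish there.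
\<close>

lemma borg_marchenko:
  assumes y: "SL_family b q \<alpha> \<beta> y dy" and q: "q absolutely_integrable_on {0..b}" and \<alpha>: "\<alpha> \<ge> 0"
    and z: "SL_family b p \<alpha>' \<beta>' z dz" and p: "p absolutely_integrable_on {0..b}" and \<alpha>': "\<alpha>' \<ge> 0" and b: "b > 0"
    and W: "\<And>l. y l b * dz l b - dy l b * z l b = 0"
  shows "\<alpha>' = \<alpha>" "\<beta>' = \<beta>" "\<exists>N. negligible N \<and> (\<forall>x\<in>{0<..<b} - N. p x = q x)"
proof -
  have bb: "b \<in> {0..b}" using b by simp
  obtain C dC S dS where 1: "\<And>\<mu>. SL_sol b q \<mu> (C \<mu>) (dC \<mu>)" "\<And>\<mu>. SL_sol b q \<mu> (S \<mu>) (dS \<mu>)"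
    "\<And>\<mu>. C \<mu> b = 1" "\<And>\<mu>. dC \<mu> b = 0" "\<And>\<mu>. S \<mu> b = 0" "\<And>\<mu>. dS \<mu> b = 1"
    "\<And>x. x \<in> {0..b} \<Longrightarrow> (\<lambda>\<mu>. C \<mu> x) holomorphic_on UNIV" "\<And>x. x \<in> {0..b} \<Longrightarrow> (\<lambda>\<mu>. S \<mu> x) holomorphic_on UNIV"
    by (rule fundamental_system_at[OF q b bb]) blast
  obtain C' dC' S' dS' where 2: "\<And>\<mu>. SL_sol b p \<mu> (C' \<mu>) (dC' \<mu>)" "\<And>\<mu>. SL_sol b p \<mu> (S' \<mu>) (dS' \<mu>)"
    "\<And>\<mu>. C' \<mu> b = 1" "\<And>\<mu>. dC' \<mu> b = 0" "\<And>\<mu>. S' \<mu> b = 0" "\<And>\<mu>. dS' \<mu> b = 1"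
    "\<And>x. x \<in> {0..b} \<Longrightarrow> (\<lambda>\<mu>. C' \<mu> x) holomorphic_on UNIV" "\<And>x. x \<in> {0..b} \<Longrightarrow> (\<lambda>\<mu>. S' \<mu> x) holomorphic_on UNIV"
    by (rule fundamental_system_at[OF p b bb]) blast
  have "C (0\<^sup>2) x * S' (0\<^sup>2) x = C' (0\<^sup>2) x * S (0\<^sup>2) x" if x: "x \<in> {0..b}" for x
    by (rule cross_product_vanishes[OF y q \<alpha> z p \<alpha>' b W 1(1,3,4) 1(2,5,6) 2(1,3,4) 2(2,5,6) x 1(7,8)[OF x] 2(7,8)[OF x]])
  from potential_determined[OF b 1(1,3,4)[of "0\<^sup>2"] 1(2,5,6)[of "0\<^sup>2"] 2(1,3,4)[of "0\<^sup>2"] 2(2,5,6)[of "0\<^sup>2"] this]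
  obtain N where N: "negligible N" "\<And>x. x \<in> {0<..<b} - N \<Longrightarrow> p x = q x" by blast
  then show "\<exists>N. negligible N \<and> (\<forall>x\<in>{0<..<b} - N. p x = q x)" by blast
  have lin: "\<i> * of_real (\<alpha>' - \<alpha>) * l + (\<beta>' - \<beta>) = 0" for l
  proof -
    have yl: "SL_sol b q (l\<^sup>2) (y l) (dy l)" "y l 0 = 1" "dy l 0 = \<i> * of_real \<alpha> * l + \<beta>" using y by (auto simp: SL_family_def)
    have zl: "SL_sol b p (l\<^sup>2) (z l) (dz l)" "z l 0 = 1" "dz l 0 = \<i> * of_real \<alpha>' * l + \<beta>'" using z by (auto simp: SL_family_def)
    have "y l b * dz l b - dy l b * z l b = y l 0 * dz l 0 - dy l 0 * z l 0"
    proof (rule ac_deriv_zero_imp_eq[OF wronskian_ac_deriv[OF yl(1) zl(1)]])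
      show "negligible (insert 0 (insert b N))" using N by simp
    qed (use N(2) b in auto)
    then have "0 = 1 * (\<i> * of_real \<alpha>' * l + \<beta>') - (\<i> * of_real \<alpha> * l + \<beta>) * 1" unfolding W yl zl .
    then show ?thesis by (simp add: algebra_simps)
  qed
  show "\<beta>' = \<beta>" using lin[of 0] by simp
  then show "\<alpha>' = \<alpha>" using lin[of 1] by simp
qed

lemma SL_initial_family_imp_SL_family:
  "SL_initial_family a q \<alpha> \<beta> y dy \<Longrightarrow> SL_family a q \<alpha> \<beta> y dy"
  unfolding SL_initial_family_def SL_family_def using SL_solution_imp_SL_sol by blast

lemma SL_family_subinterval: "SL_family a q \<alpha> \<beta> y dy \<Longrightarrow> b \<le> a \<Longrightarrow> SL_family b q \<alpha> \<beta> y dy"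
  unfolding SL_family_def using SL_sol_subinterval by blast

lemma AE_lebesgue_on_iff_negligible:
  "(AE x in lebesgue_on {u<..<v::real}. P x) \<longleftrightarrow> (\<exists>N. negligible N \<and> (\<forall>x\<in>{u<..<v} - N. P x))"
proof -
  have "(AE x in lebesgue_on {u<..<v}. P x) \<longleftrightarrow> (AE x in lebesgue. x \<in> {u<..<v} \<longrightarrow> P x)"
    by (intro AE_restrict_space_iff) auto
  also have "\<dots> \<longleftrightarrow> (\<exists>N. negligible N \<and> {x. \<not> (x \<in> {u<..<v} \<longrightarrow> P x)} \<subseteq> N)"
    by (rule eventually_ae_filter_negligible)
  finally show ?thesis by blast
qed

theorem theorem5:
  fixes a b m \<alpha>0 \<alpha> :: real
    and \<beta>0 \<beta> :: complex
    and q :: "real \<Rightarrow> complex"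
    and y dy :: "complex \<Rightarrow> real \<Rightarrow> complex"
    and \<Omega>p \<Omega>m \<Omega>0 :: "complex set"
  assumes "a > 0" and "0 < b" and "b < a"
    and "L2_on 0 a q"
    and "\<alpha>0 \<ge> 0" and "\<alpha> > 0"
    and "SL_initial_family a q \<alpha>0 \<beta>0 y dy"
    and "\<Omega>p \<subseteq> {l. Delta_plus a \<alpha> \<beta> y dy l = 0}"
    and "\<Omega>m \<subseteq> {l. Delta_minus a \<alpha> \<beta> y dy l = 0}"
    and "\<Omega>0 = \<Omega>p \<union> \<Omega>m"
    and "(\<lambda>r. real (count_upto \<Omega>0 r)) \<sim>[at_top] (\<lambda>r. 2 * m * r / pi)"
    and "m > 2 * b"
  shows "\<forall>(qt :: real \<Rightarrow> complex) (\<alpha>0t :: real) (\<beta>0t :: complex)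
            (yt :: complex \<Rightarrow> real \<Rightarrow> complex) (dyt :: complex \<Rightarrow> real \<Rightarrow> complex).
     L2_on 0 a qt \<and> \<alpha>0t \<ge> 0 \<and>
     (AE x in lebesgue_on {b<..<a}. qt x = q x) \<and>
     SL_initial_family a qt \<alpha>0t \<beta>0t yt dyt \<and>
     (\<forall>l\<in>\<Omega>p. Delta_plus a \<alpha> \<beta> yt dyt l = 0) \<and>
     (\<forall>l\<in>\<Omega>m. Delta_minus a \<alpha> \<beta> yt dyt l = 0)
     \<longrightarrow> \<alpha>0t = \<alpha>0 \<and> \<beta>0t = \<beta>0 \<and> (AE x in lebesgue_on {0<..<b}. qt x = q x)"
proof (intro allI impI, elim conjE)
  fix qt :: "real \<Rightarrow> complex" and \<alpha>0t :: real and \<beta>0t :: complex and yt dyt :: "complex \<Rightarrow> real \<Rightarrow> complex"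
  assume L2t: "L2_on 0 a qt" and \<alpha>0t: "\<alpha>0t \<ge> 0" and ae: "AE x in lebesgue_on {b<..<a}. qt x = q x"
    and famt: "SL_initial_family a qt \<alpha>0t \<beta>0t yt dyt"
    and zp: "\<forall>l\<in>\<Omega>p. Delta_plus a \<alpha> \<beta> yt dyt l = 0" and zm: "\<forall>l\<in>\<Omega>m. Delta_minus a \<alpha> \<beta> yt dyt l = 0"
  note ya = SL_initial_family_imp_SL_family[OF assms(7)] and za = SL_initial_family_imp_SL_family[OF famt]
  note qa = L2_on_abs_integrable[OF assms(4)] and pa = L2_on_abs_integrable[OF L2t]
  have ba: "b \<le> a" using assms by simp
  note y = SL_family_subinterval[OF ya ba] and z = SL_family_subinterval[OF za ba]
  have q: "q absolutely_integrable_on {0..b}" and p: "qt absolutely_integrable_on {0..b}"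
    using abs_integrable_subinterval[OF qa _ ba, of 0] abs_integrable_subinterval[OF pa _ ba, of 0] by auto
  obtain N where N: "negligible N" "\<And>x. x \<in> {b<..<a} - N \<Longrightarrow> qt x = q x"
    using ae unfolding AE_lebesgue_on_iff_negligible by blast
  define W where "W l = y l b * dyt l b - dy l b * yt l b" for l
  have zero: "W l = 0" if "l \<in> \<Omega>0" for l
  proof -
    have "y l a * dyt l a - dy l a * yt l a = 0"
    proof -
      from that assms(10) consider "l \<in> \<Omega>p" | "l \<in> \<Omega>m" by blast
      then show ?thesis
      proof cases
        case 1
        then have "dy l a + (\<i> * of_real \<alpha> * l + \<beta>) * y l a = 0" "dyt l a + (\<i> * of_real \<alpha> * l + \<beta>) * yt l a = 0"
          using assms(8) zp by (auto simp: Delta_plus_def)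
        then show ?thesis by algebra
      next
        case 2
        then have "dy l a + (- \<i> * of_real \<alpha> * l + \<beta>) * y l a = 0" "dyt l a + (- \<i> * of_real \<alpha> * l + \<beta>) * yt l a = 0"
          using assms(9) zm by (auto simp: Delta_minus_def)
        then show ?thesis by algebra
      qed
    qed
    moreover have "y l a * dyt l a - dy l a * yt l a = y l b * dyt l b - dy l b * yt l b"
    proof (rule ac_deriv_zero_imp_eq[OF wronskian_ac_deriv])
      show "SL_sol a q (l\<^sup>2) (y l) (dy l)" "SL_sol a qt (l\<^sup>2) (yt l) (dyt l)" using ya za by (auto simp: SL_family_def)
      show "negligible (insert b (insert a N))" using N by simp
    qed (use N(2) assms in auto)
    ultimately show ?thesis by (simp add: W_def)
  qed
  have hol: "W holomorphic_on UNIV" unfolding W_def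
    using assms(2) by (intro holomorphic_intros SL_family_holomorphic[OF y q] SL_family_holomorphic[OF z p]) auto
  obtain K where K: "\<And>l. norm (W l) \<le> K * (1 + norm l) * exp (2 * b * \<bar>Im l\<bar>)"
    using wronskian_growth[OF y q z p assms(2)] unfolding W_def by blast
  have "W l = 0" for l
    by (rule entire_zero_count_imp_zero[OF hol _ assms(12) K zero assms(11)]) (use assms in auto)
  then have W: "y l b * dyt l b - dy l b * yt l b = 0" for l by (simp add: W_def)
  note bm = borg_marchenko[OF y q assms(5) z p \<alpha>0t assms(2) W]
  show "\<alpha>0t = \<alpha>0 \<and> \<beta>0t = \<beta>0 \<and> (AE x in lebesgue_on {0<..<b}. qt x = q x)"
    unfolding AE_lebesgue_on_iff_negligible using bm by blast
qed

end
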